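(* Let $n\ge 1$ be an integer and let $\phi:\mathbb{P}_n\to\mathbb{P}_n$ be a surjective map which satisfies $$\operatorname{Tr}\left(\phi(A)\left(\log\phi(A)-\log\phi(B)\right)-\left(\phi(A)-\phi(B)\right)\right)=\operatorname{Tr}\left(A(\log A-\log B)-(A-B)\right)$$ for all $A,B\in\mathbb{P}_n$. Then there exists a unitary or antiunitary operator $U:\mathbb{C}^n\to\mathbb{C}^n$ such that $$\phi(A)=UAU^*\quad\text{for all } A\in\mathbb{P}_n.$$
   Context: $\mathbb{M}_n$ is the algebra of all $n\times n$ complex matrices, identified with linear operators on $\mathbb{C}^n$; $\mathbb{P}_n\subset\mathbb{M}_n$ is the set of all positive definite matrices. $\operatorname{Tr}$ is the usual trace, and $\log A$ for $A\in\mathbb{P}_n$ is defined by the functional calculus for self-adjoint matrices. An antiunitary operator is a bijective conjugate-linear operator $U$ on $\mathbb{C}^n$ with $\langle Ux,Uy\rangle=\langle y,x\rangle$ for all $x,y$; its adjoint $U^*$ (the conjugate-linear operator with $\langle Ux,y\rangle=\langle U^*y,x\rangle$) equals $U^{-1}$, so $UAU^*$ is again a linear operator. *)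

theory Defs
  imports "HOL-Analysis.Analysis"
begin

text \<open>Linear in the first argument. (The inner product of the library on \<open>complex ^ 'n\<close> is the
  real one.)\<close>
definition cinner :: "complex ^ 'n \<Rightarrow> complex ^ 'n \<Rightarrow> complex" where
  "cinner x y = (\<Sum>i\<in>UNIV. x $ i * cnj (y $ i))"

definition conj_transpose :: "complex ^ 'n ^ 'n \<Rightarrow> complex ^ 'n ^ 'n" where
  "conj_transpose A = map_matrix cnj (transpose A)"

definition self_adjoint :: "complex ^ 'n ^ 'n \<Rightarrow> bool" where
  "self_adjoint A \<longleftrightarrow> conj_transpose A = A"

text \<open>For self-adjoint \<open>A\<close> the number \<open>cinner (A *v x) x\<close> is real, so taking the real part only
  serves to state positivity.\<close>
definition pos_def_matrices :: "(complex ^ 'n ^ 'n) set" where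
  "pos_def_matrices =
     {A. self_adjoint A \<and> (\<forall>x. x \<noteq> 0 \<longrightarrow> 0 < Re (cinner (A *v x) x))}"

definition unitary_matrix :: "complex ^ 'n ^ 'n \<Rightarrow> bool" where
  "unitary_matrix V \<longleftrightarrow> conj_transpose V ** V = mat 1 \<and> V ** conj_transpose V = mat 1"

definition real_diag :: "('n \<Rightarrow> real) \<Rightarrow> complex ^ 'n ^ 'n" where
  "real_diag d = (\<chi> i j. if i = j then complex_of_real (d i) else 0)"

text \<open>Functional calculus: apply \<open>f\<close> to the eigenvalues in a unitary diagonalization. The matrix
  does not depend on the diagonalization (see \<open>fun_calculus_eqI\<close> below); only meaningful for
  self-adjoint \<open>A\<close>.\<close>
definition fun_calculus :: "(real \<Rightarrow> real) \<Rightarrow> complex ^ 'n ^ 'n \<Rightarrow> complex ^ 'n ^ 'n" where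
  "fun_calculus f A =
     (THE X. \<exists>V d. unitary_matrix V \<and> A = V ** real_diag d ** conj_transpose V \<and>
                   X = V ** real_diag (\<lambda>i. f (d i)) ** conj_transpose V)"

definition matrix_log :: "complex ^ 'n ^ 'n \<Rightarrow> complex ^ 'n ^ 'n" where
  "matrix_log A = fun_calculus ln A"

definition unitary_operator :: "(complex ^ 'n \<Rightarrow> complex ^ 'n) \<Rightarrow> bool" where
  "unitary_operator U \<longleftrightarrow>
     bij U \<and> Vector_Spaces.linear (*s) (*s) U \<and> (\<forall>x y. cinner (U x) (U y) = cinner x y)"

definition conj_linear :: "(complex ^ 'n \<Rightarrow> complex ^ 'n) \<Rightarrow> bool" where
  "conj_linear U \<longleftrightarrow>
     (\<forall>x y. U (x + y) = U x + U y) \<and> (\<forall>c x. U (c *s x) = cnj c *s U x)"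

definition antiunitary_operator :: "(complex ^ 'n \<Rightarrow> complex ^ 'n) \<Rightarrow> bool" where
  "antiunitary_operator U \<longleftrightarrow>
     bij U \<and> conj_linear U \<and> (\<forall>x y. cinner (U x) (U y) = cinner y x)"

definition lin_adjoint :: "(complex ^ 'n \<Rightarrow> complex ^ 'n) \<Rightarrow> complex ^ 'n \<Rightarrow> complex ^ 'n" where
  "lin_adjoint U =
     (THE V. Vector_Spaces.linear (*s) (*s) V \<and> (\<forall>x y. cinner (U x) y = cinner x (V y)))"

definition conj_lin_adjoint :: "(complex ^ 'n \<Rightarrow> complex ^ 'n) \<Rightarrow> complex ^ 'n \<Rightarrow> complex ^ 'n" where
  "conj_lin_adjoint U = (THE V. conj_linear V \<and> (\<forall>x y. cinner (U x) y = cinner (V y) x))"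


subsection \<open>The definite descriptions are well-defined\<close>

lemma real_diag_mult_left: "(real_diag d ** W) $ i $ j = complex_of_real (d i) * W $ i $ j"
  by (simp add: real_diag_def matrix_matrix_mult_def if_distrib[where f="\<lambda>x. x * _"] cong: if_cong)

lemma real_diag_mult_right: "(W ** real_diag d) $ i $ j = W $ i $ j * complex_of_real (d j)"
  by (simp add: real_diag_def matrix_matrix_mult_def if_distrib[where f="\<lambda>x. _ * x"] cong: if_cong)

lemma fun_calculus_unique:
  assumes V: "unitary_matrix V" and W: "unitary_matrix W"
    and eq: "V ** real_diag d ** conj_transpose V = W ** real_diag e ** conj_transpose W"
  shows "V ** real_diag (\<lambda>i. f (d i)) ** conj_transpose V =
         W ** real_diag (\<lambda>i. f (e i)) ** conj_transpose W"
proof -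
  define Z where "Z = conj_transpose W ** V"
  have cancel: "conj_transpose W ** (W ** X) = X" "W ** (conj_transpose W ** X) = X"
      "conj_transpose V ** (V ** X) = X" for X :: "complex ^ 'a ^ 'a"
    using V W by (simp_all add: unitary_matrix_def matrix_mul_assoc)
  have VV: "conj_transpose V ** V = mat 1" "V ** conj_transpose V = mat 1"
    using V by (auto simp: unitary_matrix_def)
  have "conj_transpose W ** (V ** real_diag d ** conj_transpose V) ** V =
        conj_transpose W ** (W ** real_diag e ** conj_transpose W) ** V"
    by (simp add: eq)
  then have comm: "Z ** real_diag d = real_diag e ** Z"
    by (simp add: Z_def cancel VV flip: matrix_mul_assoc)
  have "Z $ i $ j * complex_of_real (f (d j)) = complex_of_real (f (e i)) * Z $ i $ j" for i j
  proof (cases "Z $ i $ j = 0")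
    case False
    have "Z $ i $ j * complex_of_real (d j) = complex_of_real (e i) * Z $ i $ j"
      using comm by (metis real_diag_mult_left real_diag_mult_right)
    with False have "d j = e i" by simp
    then show ?thesis by simp
  qed simp
  then have "Z ** real_diag (\<lambda>i. f (d i)) = real_diag (\<lambda>i. f (e i)) ** Z"
    by (simp add: vec_eq_iff real_diag_mult_left real_diag_mult_right)
  then have "W ** (Z ** real_diag (\<lambda>i. f (d i))) ** conj_transpose V =
             W ** (real_diag (\<lambda>i. f (e i)) ** Z) ** conj_transpose V"
    by simp
  then show ?thesis
    by (simp add: Z_def cancel VV flip: matrix_mul_assoc)
qed

lemma fun_calculus_eqI:
  assumes "unitary_matrix V" and "A = V ** real_diag d ** conj_transpose V"
  shows "fun_calculus f A = V ** real_diag (\<lambda>i. f (d i)) ** conj_transpose V"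
  unfolding fun_calculus_def
proof (rule the_equality)
  show "\<exists>V' d'. unitary_matrix V' \<and> A = V' ** real_diag d' ** conj_transpose V' \<and>
          V ** real_diag (\<lambda>i. f (d i)) ** conj_transpose V =
          V' ** real_diag (\<lambda>i. f (d' i)) ** conj_transpose V'"
    using assms by blast
next
  fix X
  assume "\<exists>V' d'. unitary_matrix V' \<and> A = V' ** real_diag d' ** conj_transpose V' \<and>
          X = V' ** real_diag (\<lambda>i. f (d' i)) ** conj_transpose V'"
  then show "X = V ** real_diag (\<lambda>i. f (d i)) ** conj_transpose V"
    using assms fun_calculus_unique by metis
qed

lemma cinner_axis: "cinner x (axis i 1) = x $ i" "cinner (axis i 1) x = cnj (x $ i)"
  by (simp_all add: cinner_def axis_def if_distrib[where f="\<lambda>x. x * _"]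
      if_distrib[where f="\<lambda>x. _ * x"] if_distrib[where f=cnj] cong: if_cong)

lemma cinner_ext_left: "(\<And>y. cinner x y = cinner x' y) \<Longrightarrow> x = x'"
  by (simp add: vec_eq_iff) (metis cinner_axis(1))

lemma cinner_ext_right: "(\<And>y. cinner y x = cinner y x') \<Longrightarrow> x = x'"
  by (simp add: vec_eq_iff) (metis cinner_axis(2) complex_cnj_cancel_iff)

lemma lin_adjoint_unitary:
  assumes "unitary_operator U"
  shows "lin_adjoint U = inv U"
  unfolding lin_adjoint_def
proof (rule the_equality)
  have U: "bij U" "Vector_Spaces.linear (*s) (*s) U" "\<And>x y. cinner (U x) (U y) = cinner x y"
    using assms by (auto simp: unitary_operator_def)
  have inv: "U (inv U y) = y" "inv U (U y) = y" for y
    using U(1) by (auto simp: bij_is_surj surj_f_inv_f bij_is_inj)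
  interpret U: Vector_Spaces.linear "(*s)" "(*s)" U by fact
  have "Vector_Spaces.linear (*s) (*s) (inv U)"
    by unfold_locales (metis inv U.add, metis inv U.scale)
  moreover have ad: "cinner (U x) y = cinner x (inv U y)" for x y
    by (metis U(3) inv(1))
  ultimately show "Vector_Spaces.linear (*s) (*s) (inv U) \<and>
      (\<forall>x y. cinner (U x) y = cinner x (inv U y))"
    by blast
  show "V = inv U"
    if "Vector_Spaces.linear (*s) (*s) V \<and> (\<forall>x y. cinner (U x) y = cinner x (V y))" for V
    using that ad by (intro ext cinner_ext_right) metis
qed

lemma conj_lin_adjoint_antiunitary:
  assumes "antiunitary_operator U"
  shows "conj_lin_adjoint U = inv U"
  unfolding conj_lin_adjoint_def
proof (rule the_equality)
  have U: "bij U" "conj_linear U" "\<And>x y. cinner (U x) (U y) = cinner y x"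
    using assms by (auto simp: antiunitary_operator_def)
  have inv: "U (inv U y) = y" "inv U (U y) = y" for y
    using U(1) by (auto simp: bij_is_surj surj_f_inv_f bij_is_inj)
  have "conj_linear (inv U)"
    using U(2) unfolding conj_linear_def by (metis inv complex_cnj_cnj)
  moreover have ad: "cinner (U x) y = cinner (inv U y) x" for x y
    by (metis U(3) inv(1))
  ultimately show "conj_linear (inv U) \<and> (\<forall>x y. cinner (U x) y = cinner (inv U y) x)"
    by blast
  show "V = inv U" if "conj_linear V \<and> (\<forall>x y. cinner (U x) y = cinner (V y) x)" for V
    using that ad by (intro ext cinner_ext_left) metis
qed

end

theory Submission
  imports Defs
begin

text \<open>Write \<open>D\<close> for the divergence. The combination \<open>D(A,C) - D(A,D) - D(B,C) + D(B,D)\<close> equals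
  \<open>Tr ((A - B)(log D - log C))\<close>, so \<open>\<phi>\<close> preserves this pairing. As the differences of
  the logarithms of the values of \<open>\<phi>\<close> exhaust the Hermitian matrices, \<open>\<phi>(A) - \<phi>(B) = F(A - B)\<close> for a
  linear \<open>F\<close>, and in the same way \<open>log \<phi>(A) - log \<phi>(B) = G(log A - log B)\<close>; moreover
  \<open>\<langle>F X, G Y\<rangle> = \<langle>X, Y\<rangle>\<close>. Positivity of \<open>\<phi>\<close> and of its inverse forces \<open>\<phi>\<close> to be the
  restriction of \<open>F\<close>. Hence \<open>F\<close> and, by self-duality of the cone, \<open>G\<close> are order isomorphisms, and
  homogeneity of \<open>F\<close> gives \<open>G 1 = 1\<close>. An order isomorphism maps extremal rays of the cone to extremal
  rays, that is, rank one matrices \<open>x x\<^sup>*\<close> to rank one matrices; together with \<open>G 1 = 1\<close> this makes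
  \<open>G\<close> a unitary or antiunitary conjugation. Then \<open>G\<close> is an isometry, so \<open>F = G\<close>.\<close>

section \<open>Hermitian matrices\<close>

lemma conj_transpose_nth [simp]: "conj_transpose A $ i $ j = cnj (A $ j $ i)"
  by (simp add: conj_transpose_def transpose_def)

lemma self_adjoint_nth: "self_adjoint A \<longleftrightarrow> (\<forall>i j. A $ i $ j = cnj (A $ j $ i))"
  unfolding self_adjoint_def vec_eq_iff by (metis conj_transpose_nth)

lemma conj_transpose_mult: "conj_transpose (A ** B) = conj_transpose B ** conj_transpose A"
  by (simp add: vec_eq_iff matrix_matrix_mult_def mult.commute)

lemma conj_transpose_conj_transpose [simp]: "conj_transpose (conj_transpose A) = A"
  by (simp add: vec_eq_iff)

lemma self_adjoint_0 [simp]: "self_adjoint 0"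
  by (simp add: self_adjoint_nth)

lemma self_adjoint_mat_1 [simp]: "self_adjoint (mat 1)"
  by (simp add: self_adjoint_nth mat_def)

lemma conj_transpose_add: "conj_transpose (A + B) = conj_transpose A + conj_transpose B"
  by (simp add: vec_eq_iff)

lemma conj_transpose_diff: "conj_transpose (A - B) = conj_transpose A - conj_transpose B"
  by (simp add: vec_eq_iff)

lemma conj_transpose_minus: "conj_transpose (- A) = - conj_transpose A"
  by (simp add: vec_eq_iff)

lemma conj_transpose_scaleR: "conj_transpose (r *\<^sub>R A) = r *\<^sub>R conj_transpose A"
  by (simp add: vec_eq_iff)

lemma self_adjoint_add: "self_adjoint A \<Longrightarrow> self_adjoint B \<Longrightarrow> self_adjoint (A + B)"
  by (simp add: self_adjoint_def conj_transpose_add)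

lemma self_adjoint_diff: "self_adjoint A \<Longrightarrow> self_adjoint B \<Longrightarrow> self_adjoint (A - B)"
  by (simp add: self_adjoint_def conj_transpose_diff)

lemma self_adjoint_minus: "self_adjoint A \<Longrightarrow> self_adjoint (- A)"
  by (simp add: self_adjoint_def conj_transpose_minus)

lemma self_adjoint_scaleR: "self_adjoint A \<Longrightarrow> self_adjoint (r *\<^sub>R A)"
  by (simp add: self_adjoint_def conj_transpose_scaleR)

lemma self_adjoint_conjugate:
  "self_adjoint A \<Longrightarrow> self_adjoint (V ** A ** conj_transpose V)"
  by (simp add: self_adjoint_def conj_transpose_mult matrix_mul_assoc)

text \<open>Links the complex form to the real inner product of the library, in which positivity and
  the trace pairing are expressed from here on.\<close>

lemma Re_cinner: "Re (cinner x y) = x \<bullet> y"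
  by (simp add: cinner_def inner_vec_def inner_complex_def)

lemma cinner_matrix: "cinner (A *v x) y = cinner x (conj_transpose A *v y)"
  by (simp add: cinner_def matrix_vector_mult_def sum_distrib_left sum_distrib_right,
      subst sum.swap, simp add: mult_ac)

lemma self_adjoint_inner:
  assumes "self_adjoint A"
  shows "(A *v x) \<bullet> y = x \<bullet> (A *v y)"
proof -
  have "cinner (A *v x) y = cinner x (A *v y)"
    using assms by (simp add: cinner_matrix self_adjoint_def)
  then show ?thesis by (metis Re_cinner)
qed

text \<open>For Hermitian \<open>B\<close> the entry \<open>B $ j $ i\<close> is the conjugate of
  \<open>B $ i $ j\<close>, so the library inner product is the Hilbert-Schmidt pairing.\<close>

lemma Re_trace_mult:
  assumes "self_adjoint B"
  shows "Re (trace (A ** B)) = A \<bullet> B"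
proof -
  have B: "B $ j $ i = cnj (B $ i $ j)" for i j
    using assms unfolding self_adjoint_nth by blast
  have "Re (A $ i $ j * B $ j $ i) = A $ i $ j \<bullet> B $ i $ j" for i j
    by (subst B) (simp add: inner_complex_def)
  then show ?thesis
    by (simp add: trace_def matrix_matrix_mult_def inner_vec_def)
qed

lemma matrix_vector_mult_scaleR_left: "(r *\<^sub>R A) *v x = r *\<^sub>R (A *v x)" for A :: "complex ^ 'n ^ 'm"
  by (simp add: vec_eq_iff matrix_vector_mult_def scaleR_sum_right)

lemma matrix_vector_mult_scaleR_right: "A *v (r *\<^sub>R x) = r *\<^sub>R (A *v x)" for A :: "complex ^ 'n ^ 'm"
  by (simp add: vec_eq_iff matrix_vector_mult_def scaleR_sum_right)

section \<open>Positive semidefinite and rank one matrices\<close>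

definition psd :: "complex ^ 'n ^ 'n \<Rightarrow> bool" where
  "psd A \<longleftrightarrow> self_adjoint A \<and> (\<forall>x. 0 \<le> (A *v x) \<bullet> x)"

lemma pos_def_iff:
  "A \<in> pos_def_matrices \<longleftrightarrow> self_adjoint A \<and> (\<forall>x. x \<noteq> 0 \<longrightarrow> 0 < (A *v x) \<bullet> x)"
  by (simp add: pos_def_matrices_def Re_cinner)

lemma psd_pos_def: "A \<in> pos_def_matrices \<Longrightarrow> psd A"
  unfolding pos_def_iff psd_def by (metis inner_zero_right order_le_less)

definition rank_one :: "complex ^ 'n \<Rightarrow> complex ^ 'n ^ 'n" where
  "rank_one x = (\<chi> i j. x $ i * cnj (x $ j))"

lemma rank_one_nth [simp]: "rank_one x $ i $ j = x $ i * cnj (x $ j)"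
  by (simp add: rank_one_def)

text \<open>Quadratic forms become pairings with rank one matrices, the link between positivity and
  duality.\<close>

lemma inner_rank_one: "A \<bullet> rank_one x = (A *v x) \<bullet> x"
proof -
  have "A $ i $ j \<bullet> (x $ i * cnj (x $ j)) = (A $ i $ j * x $ j) \<bullet> x $ i" for i j
    by (simp add: inner_complex_def algebra_simps)
  then show ?thesis
    by (simp add: inner_vec_def matrix_vector_mult_def inner_sum_left)
qed

lemma self_adjoint_rank_one [simp]: "self_adjoint (rank_one x)"
  by (simp add: self_adjoint_nth)

lemma rank_one_mult: "rank_one x *v y = cinner y x *s x"
  by (simp add: vec_eq_iff matrix_vector_mult_def cinner_def sum_distrib_left sum_distrib_right mult_ac)

lemma cinner_add_left: "cinner (x + y) z = cinner x z + cinner y z"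
  by (simp add: cinner_def algebra_simps sum.distrib)

lemma cinner_0_left: "cinner 0 z = 0"
  by (simp add: cinner_def)

lemma cinner_scaleR_left: "cinner (r *\<^sub>R x) z = r *\<^sub>R cinner x z"
  by (simp add: cinner_def scaleR_sum_right)

lemma cinner_scale_left: "cinner (c *s x) z = c * cinner x z"
  by (simp add: cinner_def sum_distrib_left mult_ac)

lemma cinner_scale_right: "cinner x (c *s z) = cnj c * cinner x z"
  by (simp add: cinner_def sum_distrib_left mult_ac)

lemma cinner_commute: "cinner y x = cnj (cinner x y)"
  by (simp add: cinner_def mult.commute)

lemma cinner_self: "cinner x x = complex_of_real ((norm x)\<^sup>2)"
proof -
  have "cinner x x = complex_of_real (\<Sum>i\<in>UNIV. (cmod (x $ i))\<^sup>2)"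
    unfolding cinner_def complex_norm_square[symmetric] by simp
  then show ?thesis
    by (simp add: norm_vec_def L2_set_def sum_nonneg)
qed

lemma cinner_mult_inner: "(cinner y x *s x) \<bullet> y = (cmod (cinner y x))\<^sup>2"
proof -
  have "cinner (cinner y x *s x) y = cinner y x * cinner x y"
    by (simp add: cinner_scale_left)
  then have "cinner (cinner y x *s x) y = cinner y x * cnj (cinner y x)"
    by (metis cinner_commute)
  then show ?thesis
    by (metis Re_cinner Re_complex_of_real complex_norm_square)
qed

lemma psd_rank_one: "psd (rank_one x)"
  by (simp add: psd_def rank_one_mult cinner_mult_inner)

lemma psd_add: "psd A \<Longrightarrow> psd B \<Longrightarrow> psd (A + B)"
  by (simp add: psd_def self_adjoint_add matrix_vector_mult_add_rdistrib inner_left_distrib)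

lemma psd_scaleR: "0 \<le> r \<Longrightarrow> psd A \<Longrightarrow> psd (r *\<^sub>R A)"
  by (simp add: psd_def self_adjoint_scaleR matrix_vector_mult_scaleR_left)

lemma psd_0: "psd 0"
  by (simp add: psd_def)

lemma psd_sum: "finite S \<Longrightarrow> (\<And>i. i \<in> S \<Longrightarrow> psd (A i)) \<Longrightarrow> psd (sum A S)"
  by (induction S rule: finite_induct) (auto simp: psd_0 psd_add)

lemma pos_def_add_psd: "A \<in> pos_def_matrices \<Longrightarrow> psd B \<Longrightarrow> A + B \<in> pos_def_matrices"
  by (auto simp: pos_def_iff psd_def self_adjoint_add matrix_vector_mult_add_rdistrib inner_left_distrib
      intro: add_pos_nonneg)

lemma pos_def_scaleR: "0 < r \<Longrightarrow> A \<in> pos_def_matrices \<Longrightarrow> r *\<^sub>R A \<in> pos_def_matrices"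
  by (simp add: pos_def_iff self_adjoint_scaleR matrix_vector_mult_scaleR_left)

lemma pos_def_mat_1: "mat 1 \<in> pos_def_matrices"
  by (simp add: pos_def_iff)

section \<open>Sign conditions on polynomials and quadratic forms\<close>

lemma linear_coeff_nonneg:
  fixes a b :: real
  assumes "\<And>t. 0 < t \<Longrightarrow> 0 \<le> t * a + b"
  shows "0 \<le> a"
proof (rule ccontr)
  assume "\<not> 0 \<le> a"
  then show False
    \<comment> \<open>This \<open>t\<close> gives \<open>t * a = - (\<bar>b\<bar> + 1)\<close>, so
      the sum with \<open>b\<close> is negative.\<close>
    using assms[of "(\<bar>b\<bar> + 1) / (- a)"] by (auto simp: divide_pos_neg split: if_splits)
qed

lemma const_coeff_nonneg:
  fixes a b :: real
  assumes "\<And>t. 0 < t \<Longrightarrow> 0 \<le> t * a + b"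
  shows "0 \<le> b"
proof -
  have "((\<lambda>t. t * a + b) \<longlongrightarrow> 0 * a + b) (at_right 0)"
    by (intro tendsto_intros)
  moreover have "\<forall>\<^sub>F t in at_right 0. 0 \<le> t * a + b"
    using assms by (simp add: eventually_at_right_less eventually_mono[OF eventually_at_right_less])
  ultimately show ?thesis
    by (metis add_0 mult_zero_left tendsto_lowerbound trivial_limit_at_right_real)
qed

text \<open>Near 0 the linear term dominates: dividing by \<open>t\<close> for both signs and
  letting \<open>t\<close> tend to 0 shows that \<open>a\<close> and \<open>- a\<close> are
  nonnegative.\<close>

lemma quadratic_nonneg_linear_zero:
  fixes a b :: real
  assumes "\<And>t. 0 \<le> t * a + t\<^sup>2 * b"
  shows "a = 0"
proof -
  have "0 \<le> t * b + a" "0 \<le> t * b - a" if "0 < t" for t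
  proof -
    have "0 \<le> t * (t * b + a)" "0 \<le> t * (t * b - a)"
      using assms[of t] assms[of "- t"] by (simp_all add: power2_eq_square algebra_simps)
    then show "0 \<le> t * b + a" "0 \<le> t * b - a"
      using that zero_le_mult_iff by force+
  qed
  then show ?thesis
    using const_coeff_nonneg[of b a] const_coeff_nonneg[of b "- a"] by force
qed

text \<open>First-order condition at a minimum: on \<open>W\<close> the form is nonnegative and
  vanishes at \<open>x\<close>, so its derivative at \<open>x\<close> in every direction
  \<open>y\<close> of \<open>W\<close> is zero.\<close>

lemma self_adjoint_form_zero:
  assumes "self_adjoint B" and "subspace W" and "\<And>y. y \<in> W \<Longrightarrow> 0 \<le> (B *v y) \<bullet> y"
    and "x \<in> W" and "(B *v x) \<bullet> x = 0" and "y \<in> W"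
  shows "(B *v x) \<bullet> y = 0"
proof -
  have "0 \<le> t * (2 * ((B *v x) \<bullet> y)) + t\<^sup>2 * ((B *v y) \<bullet> y)" for t
  proof -
    have "x + t *\<^sub>R y \<in> W" using assms by (simp add: subspace_add subspace_scale)
    then have "0 \<le> (B *v (x + t *\<^sub>R y)) \<bullet> (x + t *\<^sub>R y)" by (rule assms)
    also have "\<dots> = t * (2 * ((B *v x) \<bullet> y)) + t\<^sup>2 * ((B *v y) \<bullet> y)"
      using assms(5) self_adjoint_inner[OF assms(1), of y x]
      by (simp add: matrix_vector_right_distrib matrix_vector_mult_scaleR_right inner_left_distrib
          inner_right_distrib power2_eq_square inner_commute algebra_simps)
    finally show ?thesis .
  qed
  then show ?thesis using quadratic_nonneg_linear_zero by fastforce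
qed

section \<open>Spectral theorem\<close>

text \<open>A square matrix with a zero row is not invertible, hence has a nontrivial kernel; the
  rows with index in \<open>I\<close> express the orthogonality conditions and row \<open>j\<close>
  is zero.\<close>

lemma exists_orthogonal_vector:
  fixes v :: "'n \<Rightarrow> complex ^ 'n"
  assumes "j \<notin> I"
  obtains x where "x \<noteq> 0" "\<And>i. i \<in> I \<Longrightarrow> cinner x (v i) = 0"
proof -
  define M :: "complex ^ 'n ^ 'n" where "M = (\<chi> i k. if i \<in> I then cnj (v i $ k) else 0)"
  have "(M ** B) $ j $ j = 0" for B :: "complex ^ 'n ^ 'n"
    using assms by (simp add: M_def matrix_matrix_mult_def)
  moreover have "(mat 1 :: complex ^ 'n ^ 'n) $ j $ j = 1"
    by (simp add: mat_def)
  ultimately have "M ** B \<noteq> mat 1" for B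
    by (metis zero_neq_one)
  then have "\<nexists>B. B ** M = mat 1"
    by (metis matrix_left_right_inverse)
  then obtain x where x: "x \<noteq> 0" "M *v x = 0"
    by (auto simp: matrix_left_invertible_ker)
  have "cinner x (v i) = 0" if "i \<in> I" for i
  proof -
    have "(M *v x) $ i = cinner x (v i)"
      using that by (simp add: M_def matrix_vector_mult_def cinner_def mult.commute)
    then show ?thesis using x by simp
  qed
  then show ?thesis using that x by blast
qed

text \<open>Induction on the index set: the vector for a new index maximizes the quadratic form over
  the unit sphere of the orthogonal complement of the eigenvectors found so far.\<close>

lemma orthonormal_eigenvectors:
  fixes A :: "complex ^ 'n ^ 'n"
    and I :: "'n set"
  assumes A: "self_adjoint A" and "finite I"
  shows "\<exists>v d. \<forall>i\<in>I. A *v v i = complex_of_real (d i) *s v i \<and>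
                 (\<forall>j\<in>I. cinner (v i) (v j) = (if i = j then 1 else 0))"
  using assms(2)
proof (induction I rule: finite_induct)
  case (insert j I)
  from insert.IH obtain v d where vd: "\<forall>i\<in>I. A *v v i = complex_of_real (d i) *s v i \<and>
                 (\<forall>j\<in>I. cinner (v i) (v j) = (if i = j then 1 else 0))"
    by (elim exE)
  have v: "A *v v i = complex_of_real (d i) *s v i" if "i \<in> I" for i
    using vd that by blast
  have vv: "cinner (v i) (v k) = (if i = k then 1 else 0)" if "i \<in> I" "k \<in> I" for i k
    using vd that by blast
  define W where "W = {x. \<forall>i\<in>I. cinner x (v i) = 0}"
  have W: "subspace W"
    unfolding subspace_def W_def by (simp add: cinner_add_left cinner_scaleR_left cinner_0_left)
  define K where "K = W \<inter> sphere 0 1"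
  obtain x0 where x0: "x0 \<noteq> 0" "x0 \<in> W"
    using exists_orthogonal_vector[OF insert(2), of v] unfolding W_def mem_Collect_eq by metis
  have "(1 / norm x0) *\<^sub>R x0 \<in> K"
    using x0 subspace_scale[OF W, of x0] by (simp add: K_def)
  moreover have "compact K"
    unfolding K_def by (intro closed_Int_compact closed_subspace W compact_sphere)
  moreover have lin: "linear ((*v) A)"
    by (intro linearI) (simp_all add: matrix_vector_right_distrib matrix_vector_mult_scaleR_right)
  then have "continuous_on K (\<lambda>x. (A *v x) \<bullet> x)"
    by (intro continuous_intros linear_continuous_on linear_conv_bounded_linear[THEN iffD1])
  ultimately obtain x where x: "x \<in> K" "\<And>y. y \<in> K \<Longrightarrow> (A *v y) \<bullet> y \<le> (A *v x) \<bullet> x"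
    using continuous_attains_sup[of K] by blast
  define m where "m = (A *v x) \<bullet> x"
  define B where "B = m *\<^sub>R mat 1 - A"
  have B: "B *v y = m *\<^sub>R y - A *v y" for y
    by (simp add: B_def matrix_vector_mult_diff_rdistrib matrix_vector_mult_scaleR_left)
  have xW: "x \<in> W" and nx: "norm x = 1" using x by (auto simp: K_def)
  \<comment> \<open>The complement is invariant: \<open>A\<close> moves to the other argument, where
    \<open>v i\<close> is an eigenvector.\<close>
  have AW: "A *v y \<in> W" if "y \<in> W" for y
  proof -
    have "cinner (A *v y) (v i) = 0" if "i \<in> I" for i
      using A \<open>y \<in> W\<close> that v[OF that]
      by (simp add: cinner_matrix self_adjoint_def W_def cinner_scale_right)
    then show ?thesis by (simp add: W_def)
  qed
  \<comment> \<open>Maximality makes the form of \<open>B\<close> nonnegative on \<open>W\<close>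
    and zero at \<open>x\<close>, so \<open>B *v x\<close> is orthogonal to \<open>W\<close>; as it
    lies in \<open>W\<close> itself, it vanishes.\<close>
  have "(B *v x) \<bullet> (B *v x) = 0"
  proof (rule self_adjoint_form_zero[OF _ W _ xW])
    show "self_adjoint B"
      unfolding B_def by (intro self_adjoint_diff self_adjoint_scaleR A) simp
    show "(B *v x) \<bullet> x = 0"
      using nx by (simp add: B m_def inner_diff_left power2_norm_eq_inner[symmetric])
    show "B *v x \<in> W"
      unfolding B by (intro subspace_diff W subspace_scale AW xW)
    show "0 \<le> (B *v y) \<bullet> y" if y: "y \<in> W" for y
    proof (cases "y = 0")
      case False
      have "(1 / norm y) *\<^sub>R y \<in> K"
        using False subspace_scale[OF W y] by (simp add: K_def)
      then have "(A *v ((1 / norm y) *\<^sub>R y)) \<bullet> ((1 / norm y) *\<^sub>R y) \<le> m"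
        unfolding m_def by (rule x)
      then have "(A *v y) \<bullet> y \<le> m * (norm y)\<^sup>2"
        using False by (simp add: matrix_vector_mult_scaleR_right field_simps power2_eq_square)
      then show ?thesis by (simp add: B inner_diff_left power2_norm_eq_inner)
    qed simp
  qed
  then have "A *v x = complex_of_real m *s x"
    unfolding vec_eq_iff by (simp add: B vec_eq_iff) (metis scaleR_conv_of_real)
  moreover have "cinner x x = 1" using nx by (simp add: cinner_self)
  moreover have "cinner x (v i) = 0" "cinner (v i) x = 0" if "i \<in> I" for i
    using xW that cinner_commute[of "v i" x] by (auto simp: W_def)
  ultimately show ?case
    using insert(2) v vv
    by (intro exI[of _ "v(j := x)"] exI[of _ "d(j := m)"]) auto
qed simp

lemma unitary_matrixI: "conj_transpose V ** V = mat 1 \<Longrightarrow> unitary_matrix V"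
  by (simp add: unitary_matrix_def matrix_left_right_inverse)

lemma spectral_theorem:
  fixes A :: "complex ^ 'n ^ 'n"
  assumes "self_adjoint A"
  obtains V d where "unitary_matrix V" "A = V ** real_diag d ** conj_transpose V"
proof -
  obtain v :: "'n \<Rightarrow> complex ^ 'n" and d where v: "\<And>i. A *v v i = complex_of_real (d i) *s v i"
    "\<And>i j. cinner (v i) (v j) = (if i = j then 1 else 0)"
    using orthonormal_eigenvectors[OF assms finite_class.finite_UNIV] by auto
  define V where "V = (\<chi> k i. v i $ k)"
  have "(conj_transpose V ** V) $ i $ j = cinner (v j) (v i)" for i j
    by (simp add: V_def matrix_matrix_mult_def cinner_def mult.commute)
  then have V: "unitary_matrix V"
    by (intro unitary_matrixI) (simp add: vec_eq_iff mat_def v)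
  have "(A ** V) $ k $ i = (A *v v i) $ k" for k i
    by (simp add: V_def matrix_matrix_mult_def matrix_vector_mult_def)
  then have "A ** V = V ** real_diag d"
    by (simp add: vec_eq_iff real_diag_mult_right v V_def mult.commute)
  then have "A = V ** real_diag d ** conj_transpose V"
    using V by (metis matrix_mul_assoc matrix_mul_rid unitary_matrix_def)
  then show ?thesis using that V by blast
qed

section \<open>Spectral decompositions and the positive cone\<close>

lemma spectral_nth:
  "(V ** real_diag d ** conj_transpose V) $ i $ j = (\<Sum>k\<in>UNIV. V $ i $ k * complex_of_real (d k) * cnj (V $ j $ k))"
  by (subst matrix_matrix_mult_def) (simp add: real_diag_mult_right)

text \<open>The decomposition into weighted rank one terms is linear in \<open>d\<close>, so sums
  and differences of matrices with a common \<open>V\<close> reduce to their eigenvalues.\<close>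

lemma spectral_sum:
  "V ** real_diag d ** conj_transpose V = (\<Sum>k\<in>UNIV. d k *\<^sub>R rank_one (column k V))"
  unfolding vec_eq_iff spectral_nth
  by (simp add: column_def) (simp add: scaleR_conv_of_real mult_ac)

lemma self_adjoint_real_diag: "self_adjoint (real_diag d)"
  by (simp add: self_adjoint_nth real_diag_def)

lemma self_adjoint_spectral: "self_adjoint (V ** real_diag d ** conj_transpose V)"
  by (intro self_adjoint_conjugate self_adjoint_real_diag)

lemma spectral_mult_inner:
  "((V ** real_diag d ** conj_transpose V) *v x) \<bullet> x
    = (\<Sum>k\<in>UNIV. d k * (cmod ((conj_transpose V *v x) $ k))\<^sup>2)"
proof -
  have "cinner x (column k V) = (conj_transpose V *v x) $ k" for k
    by (simp add: cinner_def column_def matrix_vector_mult_def mult.commute)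
  then show ?thesis
    unfolding spectral_sum inner_rank_one[symmetric]
    by (simp add: inner_sum_left inner_commute[of "rank_one _" "rank_one _"] inner_rank_one[of "rank_one _"]
        rank_one_mult cinner_mult_inner)
      (metis (no_types, lifting) cinner_commute complex_mod_cnj inner_commute inner_rank_one rank_one_mult cinner_mult_inner)
qed

lemma pos_def_spectral:
  assumes V: "unitary_matrix V"
  shows "V ** real_diag d ** conj_transpose V \<in> pos_def_matrices \<longleftrightarrow> (\<forall>i. 0 < d i)"
proof
  have unit: "conj_transpose V *v (V *v x) = x" "V *v (conj_transpose V *v x) = x" for x
    using V by (simp_all add: unitary_matrix_def matrix_vector_mul_assoc)
  {
    assume "V ** real_diag d ** conj_transpose V \<in> pos_def_matrices"
    show "\<forall>i. 0 < d i"
    proof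
      fix i
      \<comment> \<open>Evaluating the form at the \<open>i\<close>-th column of \<open>V\<close>
        isolates the eigenvalue \<open>d i\<close>.\<close>
      have "V *v axis i 1 \<noteq> 0"
        by (metis axis_eq_0_iff matrix_vector_mult_0_right unit(1) zero_neq_one)
      then have "0 < (\<Sum>k\<in>UNIV. d k * (cmod (axis i 1 $ k))\<^sup>2)"
        using \<open>_ \<in> pos_def_matrices\<close> unfolding pos_def_iff spectral_mult_inner by (metis unit(1))
      also have "\<dots> = (\<Sum>k\<in>UNIV. if k = i then d k else 0)"
        by (intro sum.cong) (auto simp: axis_def)
      finally show "0 < d i" by simp
    qed
  next
    assume d: "\<forall>i. 0 < d i"
    have "0 < (\<Sum>k\<in>UNIV. d k * (cmod ((conj_transpose V *v x) $ k))\<^sup>2)" if "x \<noteq> 0" for x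
    proof -
      have "conj_transpose V *v x \<noteq> 0"
        using that unit(2) by (metis matrix_vector_mult_0_right)
      then obtain k where "(conj_transpose V *v x) $ k \<noteq> 0"
        by (auto simp: vec_eq_iff)
      then show ?thesis
        using d by (intro sum_pos2[of _ k]) (auto intro!: mult_nonneg_nonneg intro: less_imp_le)
    qed
    then show "V ** real_diag d ** conj_transpose V \<in> pos_def_matrices"
      by (simp add: pos_def_iff self_adjoint_spectral spectral_mult_inner)
  }
qed

lemma psd_spectral:
  assumes "psd A"
  obtains V d where "unitary_matrix V" "A = V ** real_diag d ** conj_transpose V" "\<And>i. 0 \<le> d i"
proof -
  obtain V d where V: "unitary_matrix V" and A: "A = V ** real_diag d ** conj_transpose V"
    using assms spectral_theorem psd_def by blast
  have "0 \<le> d i" for i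
  proof -
    have "0 \<le> (\<Sum>k\<in>UNIV. d k * (cmod ((conj_transpose V *v (V *v axis i 1)) $ k))\<^sup>2)"
      using assms unfolding psd_def A spectral_mult_inner by blast
    also have "conj_transpose V *v (V *v axis i 1) = axis i 1"
      using V by (simp add: unitary_matrix_def matrix_vector_mul_assoc)
    also have "(\<Sum>k\<in>UNIV. d k * (cmod (axis i 1 $ k))\<^sup>2) = (\<Sum>k\<in>UNIV. if k = i then d k else 0)"
      by (intro sum.cong) (auto simp: axis_def)
    finally show ?thesis by simp
  qed
  then show ?thesis using that V A by blast
qed

text \<open>By its spectral decomposition \<open>B\<close> is a nonnegative combination of rank one
  matrices, and pairing \<open>A\<close> with each of them gives a value of its quadratic
  form.\<close>

lemma psd_inner_nonneg:
  assumes "psd A" "psd B"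
  shows "0 \<le> A \<bullet> B"
proof -
  obtain V d where B: "B = V ** real_diag d ** conj_transpose V" "\<And>i. 0 \<le> d i"
    using psd_spectral[OF assms(2)] by metis
  show ?thesis
    unfolding B(1) spectral_sum using assms(1) B(2)
    by (auto simp: inner_sum_right inner_rank_one psd_def intro!: sum_nonneg)
qed

text \<open>Self-duality of the positive cone; the converse direction tests against rank one
  matrices. It carries positivity from a map to its dual.\<close>

lemma psd_iff_inner: "psd A \<longleftrightarrow> self_adjoint A \<and> (\<forall>B. psd B \<longrightarrow> 0 \<le> A \<bullet> B)"
  using psd_inner_nonneg psd_rank_one inner_rank_one unfolding psd_def by metis

section \<open>The matrix logarithm\<close>

lemma self_adjoint_log:
  assumes "self_adjoint A"
  shows "self_adjoint (matrix_log A)"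
  using spectral_theorem[OF assms] fun_calculus_eqI self_adjoint_spectral
  unfolding matrix_log_def by metis

text \<open>Exponentiating the eigenvalues gives a preimage, so the logarithms fill the whole real
  space of Hermitian matrices.\<close>

lemma matrix_log_surj:
  assumes "self_adjoint X"
  shows "\<exists>A\<in>pos_def_matrices. matrix_log A = X"
proof -
  obtain V d where V: "unitary_matrix V" "X = V ** real_diag d ** conj_transpose V"
    using spectral_theorem[OF assms] .
  have "matrix_log (V ** real_diag (\<lambda>i. exp (d i)) ** conj_transpose V) = X"
    unfolding matrix_log_def by (subst fun_calculus_eqI[OF V(1) refl]) (simp add: V(2))
  moreover have "V ** real_diag (\<lambda>i. exp (d i)) ** conj_transpose V \<in> pos_def_matrices"
    by (simp add: pos_def_spectral V)
  ultimately show ?thesis by blast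
qed

lemma spectral_const:
  "unitary_matrix V \<Longrightarrow> V ** real_diag (\<lambda>_. r) ** conj_transpose V = r *\<^sub>R mat 1"
proof -
  assume "unitary_matrix V"
  moreover have "V ** real_diag (\<lambda>_. r) = r *\<^sub>R V"
    by (simp add: vec_eq_iff real_diag_mult_right) (simp add: scaleR_conv_of_real mult.commute)
  ultimately show ?thesis
    by (simp add: unitary_matrix_def flip: scalar_matrix_assoc)
qed

text \<open>\<open>A\<close> and \<open>r *\<^sub>R A\<close> share a diagonalization, so the
  functional equation of \<open>ln\<close> applies to each eigenvalue. This later turns homogeneity
  into a statement about logarithms.\<close>

lemma matrix_log_scaleR:
  assumes "A \<in> pos_def_matrices" "0 < r"
  shows "matrix_log (r *\<^sub>R A) = ln r *\<^sub>R mat 1 + matrix_log A"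
proof -
  obtain V d where V: "unitary_matrix V" and A: "A = V ** real_diag d ** conj_transpose V"
    using assms spectral_theorem pos_def_iff by blast
  have d: "\<And>i. 0 < d i" using assms pos_def_spectral[OF V] A by auto
  have rA: "r *\<^sub>R A = V ** real_diag (\<lambda>i. r * d i) ** conj_transpose V"
    by (simp add: A spectral_sum scaleR_sum_right)
  show ?thesis
    unfolding matrix_log_def fun_calculus_eqI[OF V rA] fun_calculus_eqI[OF V A]
    unfolding spectral_const[OF V, symmetric] spectral_sum
    using d assms(2) by (simp add: ln_mult_pos scaleR_add_left sum.distrib)
qed

lemma pos_def_differences:
  assumes "self_adjoint X"
  shows "\<exists>A\<in>pos_def_matrices. \<exists>B\<in>pos_def_matrices. X = A - B"
proof -
  obtain V d where V: "unitary_matrix V" and X: "X = V ** real_diag d ** conj_transpose V"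
    using spectral_theorem[OF assms] .
  \<comment> \<open>Both shifted spectra are positive since \<open>\<bar>d i\<bar> + d i\<close> is
    nonnegative; their difference is \<open>d\<close>.\<close>
  have "X = V ** real_diag (\<lambda>i. \<bar>d i\<bar> + 1 + d i) ** conj_transpose V
          - V ** real_diag (\<lambda>i. \<bar>d i\<bar> + 1) ** conj_transpose V"
    by (simp add: X spectral_sum scaleR_add_left sum.distrib)
  moreover have "V ** real_diag (\<lambda>i. \<bar>d i\<bar> + 1 + d i) ** conj_transpose V \<in> pos_def_matrices"
    by (simp add: pos_def_spectral[OF V]) (smt (verit))
  moreover have "V ** real_diag (\<lambda>i. \<bar>d i\<bar> + 1) ** conj_transpose V \<in> pos_def_matrices"
    by (simp add: pos_def_spectral[OF V] add_nonneg_pos)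
  ultimately show ?thesis by blast
qed

section \<open>Linear maps preserving rank one\<close>

text \<open>Hermitian matrix units, spanning the real space of Hermitian matrices. For
  \<open>i = j\<close> the two contributions add up to \<open>2 * Re a\<close>, so the imaginary
  part of \<open>a\<close> is lost.\<close>

definition herm_unit :: "'n \<Rightarrow> 'n \<Rightarrow> complex \<Rightarrow> complex ^ 'n ^ 'n" where
  "herm_unit i j a = (\<chi> k l. (if k = i then if l = j then a else 0 else 0) +
                             (if k = j then if l = i then cnj a else 0 else 0))"

lemma herm_unit_swap: "herm_unit j i (cnj a) = herm_unit i j a"
  by (simp add: herm_unit_def vec_eq_iff)

lemma herm_unit_add: "herm_unit i j (a + b) = herm_unit i j a + herm_unit i j b"
  by (simp add: herm_unit_def vec_eq_iff)

lemma herm_unit_scaleR: "herm_unit i j (r *\<^sub>R a) = r *\<^sub>R herm_unit i j a"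
  by (simp add: herm_unit_def vec_eq_iff scaleR_add_right)

lemma herm_unit_diag: "herm_unit i i a = (2 * Re a) *\<^sub>R rank_one (axis i 1)"
  by (simp add: herm_unit_def vec_eq_iff axis_def complex_add_cnj) (simp add: scaleR_conv_of_real)

text \<open>The pairs \<open>(i, j)\<close> and \<open>(j, i)\<close> both contribute to entry
  \<open>(i, j)\<close>; for Hermitian \<open>b\<close> this doubles \<open>b i j\<close>, whence
  the factor 1/2 in later expansions.\<close>

lemma herm_unit_sum:
  fixes b :: "'n::finite \<Rightarrow> 'n \<Rightarrow> complex"
  shows "(\<Sum>k\<in>UNIV. \<Sum>l\<in>UNIV. herm_unit k l (b k l)) $ i $ j = b i j + cnj (b j i)"
proof -
  have [simp]: "(\<Sum>l\<in>UNIV. if P then f l else 0) = (if P then \<Sum>l\<in>UNIV. f l else 0)"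
    for P and f :: "'n \<Rightarrow> complex"
    by simp
  show ?thesis by (simp add: herm_unit_def sum.distrib)
qed

text \<open>A curve of rank one matrices whose derivative at \<open>t = 0\<close> is the Hermitian
  unit, which makes the action of a rank one preserver on units accessible. The conjugate of
  \<open>a\<close> in the vector puts \<open>a\<close> itself at \<open>(i, j)\<close>.\<close>

lemma rank_one_two:
  assumes "i \<noteq> j"
  shows "rank_one (axis i 1 + t *\<^sub>R (cnj a *s axis j 1)) =
     rank_one (axis i 1) + t *\<^sub>R herm_unit i j a + (t\<^sup>2 * (cmod a)\<^sup>2) *\<^sub>R rank_one (axis j 1)"
proof -
  have "cnj a * a = complex_of_real ((cmod a)\<^sup>2)"
    by (metis complex_norm_square mult.commute)
  then show ?thesis
    using assms unfolding vec_eq_iff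
    by (auto simp: herm_unit_def axis_def) (auto simp: scaleR_conv_of_real power2_eq_square mult_ac)
qed

lemma rank_one_diag: "rank_one y $ k $ k = complex_of_real ((cmod (y $ k))\<^sup>2)"
  by (simp only: rank_one_nth complex_norm_square)

text \<open>The image of the curve in \<open>rank_one_two\<close> has rank one for each
  \<open>t\<close>, with known constant and quadratic terms. Nonnegativity of its diagonal for all
  \<open>t\<close> clears the diagonal of the linear coefficient \<open>M\<close>; the case
  \<open>t = 1\<close> then determines the support of \<open>M\<close> and the modulus of its
  entries.\<close>

lemma rank_one_preserver_unit:
  fixes G :: "complex ^ 'n ^ 'n \<Rightarrow> complex ^ 'n ^ 'n"
  assumes lin: "linear G" and rank: "\<And>x. \<exists>y. G (rank_one x) = rank_one y"
    and E: "\<And>i. G (rank_one (axis i 1)) = rank_one (axis i 1)"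
    and ij: "i \<noteq> j"
  shows "\<exists>b. G (herm_unit i j a) = herm_unit i j b \<and> cmod b = cmod a"
proof -
  define M where "M = G (herm_unit i j a)"
  have N: "\<exists>y. rank_one (axis i 1) + t *\<^sub>R M + (t\<^sup>2 * (cmod a)\<^sup>2) *\<^sub>R rank_one (axis j 1) = rank_one y" for t
    using rank[of "axis i 1 + t *\<^sub>R (cnj a *s axis j 1)"]
    unfolding rank_one_two[OF ij] linear_add[OF lin] linear_scale[OF lin] E M_def .
  have diag: "0 \<le> (if k = i then 1 else 0) + t * Re (M $ k $ k) + t\<^sup>2 * (if k = j then (cmod a)\<^sup>2 else 0)
      \<and> t * Im (M $ k $ k) = 0" for t k
  proof -
    obtain y where "rank_one (axis i 1) + t *\<^sub>R M + (t\<^sup>2 * (cmod a)\<^sup>2) *\<^sub>R rank_one (axis j 1) = rank_one y"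
      using N by blast
    then have "(rank_one (axis i 1) + t *\<^sub>R M + (t\<^sup>2 * (cmod a)\<^sup>2) *\<^sub>R rank_one (axis j 1)) $ k $ k
        = complex_of_real ((cmod (y $ k))\<^sup>2)"
      by (simp only: rank_one_diag)
    then show ?thesis
      by (auto simp: axis_def complex_eq_iff split: if_splits)
  qed
  have Mkk: "M $ k $ k = 0" for k
  proof -
    have "Im (M $ k $ k) = 0" using diag[where t = 1] by simp
    moreover have "Re (M $ k $ k) = 0"
    proof (cases "k = i")
      case True
      \<comment> \<open>For \<open>k = i\<close> there is a constant term 1 and no quadratic term,
        so letting \<open>t\<close> grow with either sign forces the coefficient to vanish.\<close>
      have "0 \<le> t * Re (M $ k $ k) + 1" "0 \<le> t * (- Re (M $ k $ k)) + 1" for t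
        using diag[where t = t and k = k] diag[where t = "- t" and k = k] ij True by simp_all
      from linear_coeff_nonneg[OF this(1)] linear_coeff_nonneg[OF this(2)] show ?thesis by linarith
    next
      case False
      then have "0 \<le> t * Re (M $ k $ k) + t\<^sup>2 * (if k = j then (cmod a)\<^sup>2 else 0)" for t
        using diag[where t = t and k = k] by simp
      then show ?thesis by (rule quadratic_nonneg_linear_zero)
    qed
    ultimately show ?thesis by (simp add: complex_eq_iff)
  qed
  obtain y where y: "rank_one (axis i 1) + M + (cmod a)\<^sup>2 *\<^sub>R rank_one (axis j 1) = rank_one y"
    using N[of 1] by auto
  have y1: "(cmod (y $ k))\<^sup>2 = (if k = i then 1 else if k = j then (cmod a)\<^sup>2 else 0)" for k
  proof -
    have "complex_of_real ((cmod (y $ k))\<^sup>2) = (rank_one (axis i 1) + M + (cmod a)\<^sup>2 *\<^sub>R rank_one (axis j 1)) $ k $ k"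
      unfolding y rank_one_diag ..
    also have "\<dots> = complex_of_real (if k = i then 1 else if k = j then (cmod a)\<^sup>2 else 0)"
      using ij by (simp add: Mkk axis_def) (simp add: scaleR_conv_of_real)
    finally show ?thesis by (simp only: of_real_eq_iff)
  qed
  have y0: "y $ k = 0" if "k \<noteq> i" "k \<noteq> j" for k
    using y1[of k] that by simp
  have Mkl: "M $ k $ l = y $ k * cnj (y $ l)" if "k \<noteq> l" for k l
  proof -
    have "(rank_one (axis i 1) + M + (cmod a)\<^sup>2 *\<^sub>R rank_one (axis j 1)) $ k $ l = M $ k $ l"
      using that by (auto simp: axis_def)
    then show ?thesis by (simp add: y)
  qed
  have "M = herm_unit i j (y $ i * cnj (y $ j))"
    unfolding vec_eq_iff
  proof (intro allI)
    fix k l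
    show "M $ k $ l = herm_unit i j (y $ i * cnj (y $ j)) $ k $ l"
      using ij by (cases "k = l") (auto simp: Mkk Mkl herm_unit_def y0 mult.commute)
  qed
  moreover have "cmod (y $ i * cnj (y $ j)) = cmod a"
  proof -
    have "(cmod (y $ i))\<^sup>2 = 1\<^sup>2" "(cmod (y $ j))\<^sup>2 = (cmod a)\<^sup>2" using y1[of i] y1[of j] ij by auto
    then have "cmod (y $ i) = 1" "cmod (y $ j) = cmod a" by (simp_all only: power2_eq_iff_nonneg norm_ge_zero zero_le_one)
    then show ?thesis by (simp add: norm_mult)
  qed
  ultimately show ?thesis unfolding M_def by blast
qed

text \<open>Hermitian units go to Hermitian units at the same position, and they span; so on
  Hermitian matrices the map acts on each entry separately.\<close>

lemma rank_one_preserver_entries: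
  fixes G :: "complex ^ 'n ^ 'n \<Rightarrow> complex ^ 'n ^ 'n"
  assumes lin: "linear G" and rank: "\<And>x. \<exists>y. G (rank_one x) = rank_one y"
    and E: "\<And>i. G (rank_one (axis i 1)) = rank_one (axis i 1)"
  obtains g where "\<And>X i j. self_adjoint X \<Longrightarrow> G X $ i $ j = g i j (X $ i $ j)"
    and "\<And>i a. g i i a = a"
    and "\<And>i j. linear (g i j)" and "\<And>i j a. cmod (g i j a) = cmod a"
    and "\<And>i j a. g j i (cnj a) = cnj (g i j a)"
proof -
  \<comment> \<open>The diagonal is set apart because \<open>herm_unit i i a\<close> keeps only the
    real part of \<open>a\<close>: reading off the entry would give \<open>2 * Re a\<close>, which
    is no isometry.\<close>
  define g where "g i j a = (if i = j then a else G (herm_unit i j a) $ i $ j)" for i j a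
  have G: "G (herm_unit i j a) = herm_unit i j (g i j a) \<and> cmod (g i j a) = cmod a" for i j a
  proof (cases "i = j")
    case True
    then show ?thesis
      by (simp add: g_def herm_unit_diag linear_scale[OF lin] E)
  next
    case False
    obtain b where b: "G (herm_unit i j a) = herm_unit i j b" "cmod b = cmod a"
      using rank_one_preserver_unit[OF lin rank E False] by blast
    then have "g i j a = b" using False by (simp add: g_def herm_unit_def)
    then show ?thesis using b by simp
  qed
  have swap: "g j i (cnj a) = cnj (g i j a)" for i j a
  proof (cases "i = j")
    case False
    then show ?thesis
      using arg_cong[OF conjunct1[OF G[of i j a]], of "\<lambda>M. M $ j $ i"]
      by (simp add: g_def herm_unit_swap) (simp add: herm_unit_def)
  qed (simp add: g_def)
  have "linear (g i j)" for i j
    by (intro linearI) (simp_all add: g_def herm_unit_add herm_unit_scaleR linear_add[OF lin] linear_scale[OF lin])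
  moreover have "G X $ i $ j = g i j (X $ i $ j)" if X: "self_adjoint X" for X i j
  proof -
    have Xc: "X $ l $ k = cnj (X $ k $ l)" for k l
      using X unfolding self_adjoint_nth by blast
    have sum: "((1/2) *\<^sub>R (\<Sum>k\<in>UNIV. \<Sum>l\<in>UNIV. herm_unit k l (b k l))) $ i $ j = b i j"
      if "b j i = cnj (b i j)" for b i j
      unfolding vector_scaleR_component herm_unit_sum that by (simp add: scaleR_conv_of_real)
    have "X = (1/2) *\<^sub>R (\<Sum>k\<in>UNIV. \<Sum>l\<in>UNIV. herm_unit k l (X $ k $ l))"
      unfolding vec_eq_iff using sum[of "\<lambda>k l. X $ k $ l", OF Xc] by metis
    then have GX: "G X = (1/2) *\<^sub>R (\<Sum>k\<in>UNIV. \<Sum>l\<in>UNIV. herm_unit k l (g k l (X $ k $ l)))"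
      by (metis (no_types, lifting) G linear_scale[OF lin] linear_sum[OF lin] sum.cong)
    have "g j i (X $ j $ i) = cnj (g i j (X $ i $ j))"
      by (subst Xc) (rule swap)
    then show ?thesis
      unfolding GX by (rule sum[of "\<lambda>k l. g k l (X $ k $ l)"])
  qed
  moreover have "g i i a = a" for i a by (simp add: g_def)
  ultimately show ?thesis using that G swap by blast
qed

text \<open>A real-linear isometry of the complex plane that fixes 1 is the identity or the
  conjugation; fixing the all-ones matrix puts every entry map in this situation. It remains to see
  that the choice is the same at all off-diagonal positions.\<close>

lemma rank_one_preserver_normalized:
  fixes G :: "complex ^ 'n ^ 'n \<Rightarrow> complex ^ 'n ^ 'n"
  assumes lin: "linear G" and rank: "\<And>x. \<exists>y. G (rank_one x) = rank_one y"
    and E: "\<And>i. G (rank_one (axis i 1)) = rank_one (axis i 1)"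
    and J: "G (rank_one (\<chi> i. 1)) = rank_one (\<chi> i. 1)"
  shows "(\<forall>X. self_adjoint X \<longrightarrow> G X = X) \<or> (\<forall>X. self_adjoint X \<longrightarrow> G X = map_matrix cnj X)"
proof -
  obtain g where g: "\<And>X i j. self_adjoint X \<Longrightarrow> G X $ i $ j = g i j (X $ i $ j)"
    and gii: "\<And>i a. g i i a = a"
    and glin: "\<And>i j. linear (g i j)" and gnorm: "\<And>i j a. cmod (g i j a) = cmod a"
    and gswap: "\<And>i j a. g j i (cnj a) = cnj (g i j a)"
    using rank_one_preserver_entries[OF lin rank E] by blast
  have g1: "g i j 1 = 1" for i j
    using g[of "rank_one (\<chi> i. 1)" i j] J by simp
  have gform: "g i j a = of_real (Re a) + of_real (Im a) * g i j \<i>" for i j a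
  proof -
    have "g i j a = g i j (Re a *\<^sub>R 1 + Im a *\<^sub>R \<i>)"
      by (rule arg_cong[of _ _ "g i j"]) (simp add: complex_eq_iff)
    also have "\<dots> = Re a *\<^sub>R g i j 1 + Im a *\<^sub>R g i j \<i>"
      by (simp only: linear_add[OF glin] linear_scale[OF glin])
    finally show ?thesis by (simp add: g1 scaleR_conv_of_real)
  qed
  have gi: "g i j \<i> = \<i> \<or> g i j \<i> = - \<i>" for i j
  proof -
    have 1: "(Re (g i j \<i>))\<^sup>2 + (Im (g i j \<i>))\<^sup>2 = 1"
      using gnorm[of i j \<i>] by (simp add: cmod_def)
    \<comment> \<open>The moduli of \<open>g i j \<i>\<close> and \<open>1 + g i j \<i>\<close> are
      1 and the square root of 2, which forces the real part to vanish.\<close>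
    have "g i j (1 + \<i>) = 1 + g i j \<i>"
      using gform[of i j "1 + \<i>"] by simp
    then have "(1 + Re (g i j \<i>))\<^sup>2 + (Im (g i j \<i>))\<^sup>2 = 2"
      using gnorm[of i j "1 + \<i>"] by (simp add: cmod_def)
    with 1 have "Re (g i j \<i>) = 0" by (simp add: power2_sum)
    moreover from this 1 have "Im (g i j \<i>) = 1 \<or> Im (g i j \<i>) = - 1"
      by (simp add: power2_eq_1_iff)
    ultimately show ?thesis by (auto simp: complex_eq_iff)
  qed
  have gi_swap: "g j i \<i> = g i j \<i>" for i j
    using gswap[of j i "- \<i>"] gi[of i j] linear_neg[OF glin, of i j \<i>] by (auto simp: linear_neg[OF glin])
  \<comment> \<open>The three entries of a rank one matrix at \<open>(i,j)\<close>, \<open>(i,k)\<close>, \<open>(j,k)\<close> are tied together, so the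
    choice between identity and conjugation cannot vary along a row.\<close>
  have gi_eq: "g i j \<i> = g i k \<i>" if "i \<noteq> j" "i \<noteq> k" for i j k
  proof (cases "j = k")
    case False
    define x where "x = (\<chi> l. if l = i then \<i> else 1)"
    obtain y where y: "G (rank_one x) = rank_one y" using rank by blast
    have entry: "y $ p * cnj (y $ q) = g p q (x $ p * cnj (x $ q))" for p q
      using g[of "rank_one x" p q] y by simp
    \<comment> \<open>These two equations give \<open>y $ j = y $ k\<close>, so the entries of row
      \<open>i\<close> in columns \<open>j\<close> and \<open>k\<close> coincide.\<close>
    have "y $ j * cnj (y $ j) = 1" "y $ j * cnj (y $ k) = 1"
      using entry[of j j] entry[of j k] that by (simp_all add: x_def g1)
    moreover have "y $ i * cnj (y $ j) = g i j \<i>" "y $ i * cnj (y $ k) = g i k \<i>"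
      using entry[of i j] entry[of i k] that by (simp_all add: x_def)
    ultimately show ?thesis
      by (metis mult.assoc mult.commute mult.right_neutral)
  qed simp
  have const: "g i j \<i> = g k l \<i>" if "i \<noteq> j" "k \<noteq> l" for i j k l
  proof (cases "i = l")
    case True
    then show ?thesis using gi_eq[of i j k] gi_swap[of k l] that by simp
  next
    case False
    then show ?thesis using gi_eq[of i j l] gi_eq[of l i k] gi_swap[of i l] gi_swap[of k l] that by metis
  qed
  consider (lin) "\<forall>i j. i \<noteq> j \<longrightarrow> g i j \<i> = \<i>" | (conj) "\<forall>i j. i \<noteq> j \<longrightarrow> g i j \<i> = - \<i>"
    using gi const by metis
  then show ?thesis
  proof cases
    case lin
    then have "g i j a = a" for i j a
      using gform[of i j a] gii by (cases "i = j") (auto simp: complex_eq_iff)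
    then show ?thesis by (simp add: vec_eq_iff g)
  next
    case conj
    have "G X = map_matrix cnj X" if X: "self_adjoint X" for X
    proof -
      have "G X $ i $ j = cnj (X $ i $ j)" for i j
      proof (cases "i = j")
        \<comment> \<open>Diagonal entries of a Hermitian matrix are real, so identity and
          conjugation agree on them.\<close>
        case True
        then show ?thesis using X g[OF X] gii unfolding self_adjoint_nth by metis
      next
        case False
        then show ?thesis
          using conj g[OF X] gform[of i j "X $ i $ j"] by (simp add: complex_eq_iff)
      qed
      then show ?thesis by (simp add: vec_eq_iff)
    qed
    then show ?thesis by blast
  qed
qed

section \<open>Unitary conjugation and reduction to the normalized case\<close>

lemma rank_one_conjugate: "V ** rank_one x ** conj_transpose V = rank_one (V *v x)"
  by (simp add: vec_eq_iff matrix_matrix_mult_def matrix_vector_mult_def sum_distrib_left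
      sum_distrib_right mult_ac)

lemma sum_rank_one_columns: "(\<Sum>i\<in>UNIV. rank_one (column i V)) = V ** conj_transpose V"
  by (simp add: vec_eq_iff matrix_matrix_mult_def column_def)

lemma matrix_add_rdistrib: "(A + B) ** C = A ** C + B ** C" for A :: "'a::semiring_1 ^ 'n ^ 'm"
  by (simp add: vec_eq_iff matrix_matrix_mult_def sum.distrib distrib_right)

lemma matrix_vector_mult_axis: "A *v axis k 1 = column k A" for A :: "'a::semiring_1 ^ 'n ^ 'm"
  by (simp add: vec_eq_iff matrix_vector_mult_def column_def axis_def if_distrib[of "\<lambda>x. _ * x"] cong: if_cong)

lemma sum_rank_one_axis: "(\<Sum>i\<in>UNIV. rank_one (axis i 1 :: complex ^ 'n)) = mat 1"
proof -
  have "axis i 1 $ k * cnj (axis i 1 $ l) = (if i = k then if k = l then 1 else 0 else 0)" for i k l :: 'n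
    by (simp add: axis_def)
  then show ?thesis by (simp add: vec_eq_iff mat_def)
qed

lemma linear_conjugate:
  fixes V W :: "complex ^ 'n ^ 'n"
  assumes "linear G"
  shows "linear (\<lambda>X. V ** G X ** W)"
proof (rule linearI)
  show "V ** G (X + Y) ** W = V ** G X ** W + V ** G Y ** W" for X Y
    by (simp only: linear_add[OF assms] matrix_add_ldistrib matrix_add_rdistrib)
  show "V ** G (r *\<^sub>R X) ** W = r *\<^sub>R (V ** G X ** W)" for r X
    by (simp only: linear_scale[OF assms] matrix_scalar_ac scalar_matrix_assoc)
qed

lemma unitary_matrix_mult:
  assumes "unitary_matrix V" "unitary_matrix W"
  shows "unitary_matrix (V ** W)"
proof (rule unitary_matrixI)
  have "conj_transpose (V ** W) ** (V ** W) = conj_transpose W ** (conj_transpose V ** V) ** W"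
    by (simp only: conj_transpose_mult matrix_mul_assoc)
  then show "conj_transpose (V ** W) ** (V ** W) = mat 1"
    using assms by (simp add: unitary_matrix_def)
qed

lemma unitary_matrix_conj_transpose: "unitary_matrix V \<Longrightarrow> unitary_matrix (conj_transpose V)"
  by (simp add: unitary_matrix_def)

text \<open>Two conjugations reduce to the normalized case: \<open>Q\<close> brings the images of
  the coordinate projections back to their place, and the diagonal unitary \<open>D\<close> corrects
  the phases so that the all-ones matrix is fixed.\<close>

lemma rank_one_preserver:
  fixes G :: "complex ^ 'n ^ 'n \<Rightarrow> complex ^ 'n ^ 'n"
  assumes lin: "linear G" and rank: "\<And>x. \<exists>y. G (rank_one x) = rank_one y"
    and unit: "G (mat 1) = mat 1"
  obtains W where "unitary_matrix W"
    and "(\<forall>X. self_adjoint X \<longrightarrow> G X = W ** X ** conj_transpose W) \<or>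
         (\<forall>X. self_adjoint X \<longrightarrow> G X = W ** map_matrix cnj X ** conj_transpose W)"
proof -
  obtain q where q: "\<And>i. G (rank_one (axis i 1)) = rank_one (q i)"
    using choice[of "\<lambda>i y. G (rank_one (axis i 1)) = rank_one y"] rank by blast
  define Q where "Q = (\<chi> k i. q i $ k)"
  have col: "column i Q = q i" for i by (simp add: column_def Q_def)
  have Qax: "Q *v axis i 1 = q i" for i
    by (simp add: matrix_vector_mult_axis col)
  \<comment> \<open>The coordinate projections sum to the identity, which \<open>G\<close> fixes;
    this is what makes \<open>Q\<close> unitary.\<close>
  have "G (mat 1) = (\<Sum>i\<in>UNIV. rank_one (q i))"
    by (simp add: linear_sum[OF lin] q flip: sum_rank_one_axis)
  then have "Q ** conj_transpose Q = mat 1"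
    by (simp add: unit col flip: sum_rank_one_columns)
  then have Q: "unitary_matrix Q"
    by (simp add: unitary_matrix_def matrix_left_right_inverse)
  have Q': "conj_transpose Q *v q i = axis i 1" for i
    using Q by (simp add: matrix_vector_mul_assoc unitary_matrix_def flip: Qax)
  obtain z where z: "G (rank_one (\<chi> i. 1)) = rank_one z" using rank by blast
  define w where "w = conj_transpose Q *v z"
  define G1 where "G1 X = conj_transpose Q ** G X ** conj_transpose (conj_transpose Q)" for X
  have G1: "linear G1"
    unfolding G1_def by (intro linear_conjugate lin)
  have "\<exists>y. G1 (rank_one x) = rank_one y" for x
    using rank[of x] unfolding G1_def by (metis rank_one_conjugate)
  moreover have "G1 (rank_one (axis i 1)) = rank_one (axis i 1)" for i
    unfolding G1_def q rank_one_conjugate Q' ..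
  ultimately obtain g where g: "\<And>X i j. self_adjoint X \<Longrightarrow> G1 X $ i $ j = g i j (X $ i $ j)"
    "\<And>i a. g i i a = a"
    using rank_one_preserver_entries[OF G1] by metis
  \<comment> \<open>The diagonal entries of the all-ones matrix are kept, so every entry of
    \<open>w\<close> has modulus 1.\<close>
  have w: "w $ i * cnj (w $ i) = 1" for i
    using g(1)[of "rank_one (\<chi> i. 1)" i i] g(2)
    unfolding G1_def z rank_one_conjugate w_def[symmetric] by simp
  define D where "D = (\<chi> i j. if i = j then cnj (w $ i) else 0)"
  have Dv: "D *v x = (\<chi> i. cnj (w $ i) * x $ i)" for x
    by (simp add: D_def matrix_vector_mult_def vec_eq_iff if_distrib[of "\<lambda>x. x * _"] cong: if_cong)
  have "D ** conj_transpose D = mat 1"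
    using w by (simp add: D_def matrix_matrix_mult_def vec_eq_iff mat_def mult.commute
        if_distrib[of "\<lambda>x. x * _"] if_distrib[of "\<lambda>x. _ * x"] cong: if_cong)
  then have D: "unitary_matrix D"
    by (simp add: unitary_matrix_def matrix_left_right_inverse)
  define V where "V = D ** conj_transpose Q"
  have V: "unitary_matrix V"
    unfolding V_def by (intro unitary_matrix_mult D unitary_matrix_conj_transpose Q)
  define G2 where "G2 X = V ** G X ** conj_transpose V" for X
  have G2: "linear G2"
    unfolding G2_def by (intro linear_conjugate lin)
  have r2: "\<exists>y. G2 (rank_one x) = rank_one y" for x
    using rank[of x] unfolding G2_def by (metis rank_one_conjugate)
  have e2: "G2 (rank_one (axis i 1)) = rank_one (axis i 1)" for i
  proof -
    have "V *v q i = D *v axis i 1"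
      unfolding V_def by (simp add: Q' flip: matrix_vector_mul_assoc)
    \<comment> \<open>\<open>D\<close> changes \<open>axis i 1\<close> by a phase, which a rank one
      matrix does not see.\<close>
    also have "rank_one (D *v axis i 1) = rank_one (axis i 1)"
      using w[of i] unfolding Dv by (simp add: vec_eq_iff axis_def mult.commute)
    finally show ?thesis unfolding G2_def q rank_one_conjugate .
  qed
  have "V *v z = D *v w"
    unfolding V_def w_def by (simp flip: matrix_vector_mul_assoc)
  also have "\<dots> = (\<chi> i. 1)"
    unfolding Dv by (simp add: w mult.commute)
  finally have j2: "G2 (rank_one (\<chi> i. 1)) = rank_one (\<chi> i. 1)"
    unfolding G2_def z rank_one_conjugate by (rule arg_cong)
  \<comment> \<open>Undoes the conjugation; the unitary sought is \<open>conj_transpose V\<close>,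
    hence the double \<open>conj_transpose\<close>.\<close>
  have G: "G X = conj_transpose V ** G2 X ** conj_transpose (conj_transpose V)" for X
  proof -
    have "conj_transpose V ** G2 X ** V = (conj_transpose V ** V) ** G X ** (conj_transpose V ** V)"
      unfolding G2_def by (simp only: matrix_mul_assoc)
    then show ?thesis using V by (simp add: unitary_matrix_def)
  qed
  show ?thesis
  proof (rule that[OF unitary_matrix_conj_transpose[OF V]])
    show "(\<forall>X. self_adjoint X \<longrightarrow> G X = conj_transpose V ** X ** conj_transpose (conj_transpose V)) \<or>
          (\<forall>X. self_adjoint X \<longrightarrow> G X = conj_transpose V ** map_matrix cnj X ** conj_transpose (conj_transpose V))"
      unfolding G using rank_one_preserver_normalized[OF G2 r2 e2 j2] by auto
  qed
qed

section \<open>The order on Hermitian matrices\<close>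

text \<open>Subtracting from \<open>v\<close> its projection to \<open>x\<close> leaves
  \<open>z\<close> orthogonal to \<open>x\<close>, thus by assumption to \<open>v\<close>, thus to
  itself.\<close>

lemma exists_scale_of_orthogonal:
  assumes "\<And>z. cinner z x = 0 \<Longrightarrow> cinner z v = 0"
  shows "\<exists>c. v = c *s x"
proof -
  \<comment> \<open>For \<open>x = 0\<close> division by zero gives \<open>c = 0\<close>, and the
    argument still applies.\<close>
  define c where "c = cinner v x / cinner x x"
  define z where "z = v + (- c) *s x"
  have "cinner z x = cinner v x + (- c) * cinner x x"
    by (simp only: z_def cinner_add_left cinner_scale_left)
  also have "\<dots> = 0"
    by (cases "x = 0") (simp_all add: c_def cinner_self, simp add: cinner_def)
  finally have zx: "cinner z x = 0" .
  then have zv: "cinner z v = 0" by (rule assms)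
  have "cinner z z = cinner v z + (- c) * cinner x z"
    using cinner_add_left[of v "(- c) *s x" z] by (simp only: z_def[symmetric] cinner_scale_left)
  also have "\<dots> = 0"
    using zx zv cinner_commute[of v z] cinner_commute[of x z] by simp
  finally have "cinner z z = 0" .
  then have "z = 0" by (simp add: cinner_self)
  then have "v = c *s x" by (simp add: z_def vec_eq_iff)
  then show ?thesis by blast
qed

lemma rank_one_scale: "rank_one (c *s x) = (cmod c)\<^sup>2 *\<^sub>R rank_one x"
  using complex_norm_square[of c] by (simp add: vec_eq_iff) (simp add: scaleR_conv_of_real mult_ac)

text \<open>The quadratic form vanishes identically; the first-order condition in direction
  \<open>A *v x\<close> gives \<open>A *v x = 0\<close>.\<close>

lemma psd_antisym:
  assumes "psd A" "psd (- A)"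
  shows "A = 0"
proof -
  have "(A *v x) \<bullet> x = 0" for x
  proof -
    have "(- A) *v x = - (A *v x)"
      using matrix_vector_mult_scaleR_left[of "-1" A x] by simp
    then show ?thesis using assms unfolding psd_def by (metis antisym inner_minus_left neg_0_le_iff_le)
  qed
  then have "A *v x = 0" for x
    using self_adjoint_form_zero[of A UNIV x "A *v x"] assms unfolding psd_def by simp
  then show ?thesis by (metis matrix_eq matrix_vector_mult_0)
qed

text \<open>Rank one matrices span extremal rays: the form of \<open>Y\<close> vanishes on the
  complement of \<open>x\<close>, so each eigenvector of \<open>Y\<close> with nonzero eigenvalue is
  a multiple of \<open>x\<close>.\<close>

lemma psd_le_rank_one:
  assumes Y: "psd Y" and le: "psd (rank_one x - Y)"
  shows "\<exists>c. Y = c *\<^sub>R rank_one x"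
proof -
  obtain V d where eq: "Y = V ** real_diag d ** conj_transpose V" and d: "\<And>i. 0 \<le> d i"
    using psd_spectral[OF Y] by metis
  define v where "v k = column k V" for k
  have Ysum: "Y = (\<Sum>k\<in>UNIV. d k *\<^sub>R rank_one (v k))"
    unfolding eq spectral_sum v_def ..
  have form: "(Y *v z) \<bullet> z = (\<Sum>k\<in>UNIV. d k * (cmod (cinner z (v k)))\<^sup>2)" for z
    unfolding Ysum inner_rank_one[symmetric] inner_sum_left inner_scaleR_left
    by (simp only: inner_rank_one rank_one_mult cinner_mult_inner)
  have "\<exists>c. d k *\<^sub>R rank_one (v k) = c *\<^sub>R rank_one x" for k
  proof (cases "d k = 0")
    case False
    have "cinner z (v k) = 0" if "cinner z x = 0" for z
    proof -
      have "0 \<le> ((rank_one x - Y) *v z) \<bullet> z" using le unfolding psd_def by blast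
      also have "\<dots> = - (\<Sum>k\<in>UNIV. d k * (cmod (cinner z (v k)))\<^sup>2)"
        by (simp add: matrix_vector_mult_diff_rdistrib inner_diff_left rank_one_mult that form)
      finally have "(\<Sum>k\<in>UNIV. d k * (cmod (cinner z (v k)))\<^sup>2) \<le> 0" by simp
      moreover have "d k * (cmod (cinner z (v k)))\<^sup>2 \<le> (\<Sum>k\<in>UNIV. d k * (cmod (cinner z (v k)))\<^sup>2)"
        by (rule member_le_sum) (simp_all add: d)
      ultimately have "d k * (cmod (cinner z (v k)))\<^sup>2 \<le> 0" by linarith
      moreover have "0 < d k" using False d[of k] by simp
      ultimately have "(cmod (cinner z (v k)))\<^sup>2 \<le> 0"
        by (simp add: mult_le_0_iff)
      then show ?thesis by simp
    qed
    then obtain b where "v k = b *s x" using exists_scale_of_orthogonal by blast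
    then have "d k *\<^sub>R rank_one (v k) = (d k * (cmod b)\<^sup>2) *\<^sub>R rank_one x"
      by (simp add: rank_one_scale)
    then show ?thesis by blast
  next
    case True
    then show ?thesis by (intro exI[of _ 0]) simp
  qed
  then obtain c where "\<And>k. d k *\<^sub>R rank_one (v k) = c k *\<^sub>R rank_one x"
    using choice[of "\<lambda>k c. d k *\<^sub>R rank_one (v k) = c *\<^sub>R rank_one x"] by blast
  then have "Y = (\<Sum>k\<in>UNIV. c k) *\<^sub>R rank_one x"
    by (simp add: Ysum scaleR_sum_left)
  then show ?thesis by blast
qed

text \<open>Each spectral term of \<open>Z\<close> lies below \<open>Z\<close>, so a nonzero one is
  proportional to \<open>Z\<close>, and the factor, being nonnegative, is absorbed into the vector.
  Zero is covered as \<open>rank_one 0\<close>.\<close>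

lemma psd_extremal_rank_one:
  assumes Z: "psd Z" and ext: "\<And>Y. psd Y \<Longrightarrow> psd (Z - Y) \<Longrightarrow> \<exists>c. Y = c *\<^sub>R Z"
  shows "\<exists>y. Z = rank_one y"
proof (cases "Z = 0")
  case True
  then have "Z = rank_one 0" by (simp add: vec_eq_iff)
  then show ?thesis by blast
next
  case False
  obtain V d where eq: "Z = V ** real_diag d ** conj_transpose V" and d: "\<And>i. 0 \<le> d i"
    using psd_spectral[OF Z] by metis
  define T where "T k = d k *\<^sub>R rank_one (column k V)" for k
  have Zsum: "Z = sum T UNIV" unfolding eq spectral_sum T_def ..
  have T: "psd (T k)" for k unfolding T_def by (intro psd_scaleR d psd_rank_one)
  obtain k where k: "T k \<noteq> 0" using False Zsum by (metis sum.neutral)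
  have "Z - T k = sum T (UNIV - {k})" unfolding Zsum by (simp add: sum_diff1)
  then have "psd (Z - T k)" using T by (simp add: psd_sum)
  then obtain c where c: "T k = c *\<^sub>R Z" using ext T by blast
  then have "c \<noteq> 0" using k by auto
  define r where "r = d k / c"
  define v where "v = column k V"
  have Zr: "Z = r *\<^sub>R rank_one v"
  proof -
    have "Z = (1 / c) *\<^sub>R T k" using c \<open>c \<noteq> 0\<close> by simp
    then show ?thesis by (simp add: T_def r_def v_def)
  qed
  have "v \<noteq> 0" using k by (auto simp: T_def v_def[symmetric] vec_eq_iff)
  have "0 \<le> (Z *v v) \<bullet> v" using Z unfolding psd_def by blast
  also have "\<dots> = r * (cmod (cinner v v))\<^sup>2"
    by (simp add: Zr matrix_vector_mult_scaleR_left rank_one_mult cinner_mult_inner)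
  finally have "0 \<le> r" using \<open>v \<noteq> 0\<close> by (simp add: cinner_self zero_le_mult_iff)
  then have "(cmod (complex_of_real (sqrt r)))\<^sup>2 = r" by simp
  then have "Z = rank_one (complex_of_real (sqrt r) *s v)" unfolding rank_one_scale Zr by simp
  then show ?thesis by blast
qed

text \<open>Extremality is an order property: what lies below the image comes from something below
  \<open>rank_one x\<close>, hence from a multiple of it.\<close>

lemma order_isomorphism_rank_one:
  fixes G :: "complex ^ 'n ^ 'n \<Rightarrow> complex ^ 'n ^ 'n"
  assumes lin: "linear G"
    and psd: "\<And>X. self_adjoint X \<Longrightarrow> psd (G X) \<longleftrightarrow> psd X"
    and surj: "\<And>Y. self_adjoint Y \<Longrightarrow> \<exists>X. self_adjoint X \<and> G X = Y"
  shows "\<exists>y. G (rank_one x) = rank_one y"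
proof (rule psd_extremal_rank_one)
  show "psd (G (rank_one x))" by (simp add: psd psd_rank_one)
  fix Y assume Y: "psd Y" and le: "psd (G (rank_one x) - Y)"
  obtain X where X: "self_adjoint X" "G X = Y" using surj Y psd_def by blast
  have "psd X" using X Y psd by blast
  moreover have "psd (rank_one x - X)"
    using le psd[of "rank_one x - X"] X by (simp add: linear_diff[OF lin] self_adjoint_diff)
  ultimately obtain c where "X = c *\<^sub>R rank_one x" using psd_le_rank_one by blast
  then show "\<exists>c. Y = c *\<^sub>R G (rank_one x)" using X linear_scale[OF lin] by blast
qed

text \<open>Both claims arise by scaling: \<open>F (t *\<^sub>R mat 1) + c\<close> with
  \<open>t\<close> tending to 0 isolates \<open>c\<close>, and
  \<open>F (mat 1 + t *\<^sub>R A) + c\<close> with \<open>t\<close> growing isolates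
  \<open>F A\<close>.\<close>

lemma affine_pos_def_preserver:
  fixes F :: "complex ^ 'n ^ 'n \<Rightarrow> complex ^ 'n ^ 'n"
  assumes lin: "linear F" and sa: "\<And>X. self_adjoint X \<Longrightarrow> self_adjoint (F X)"
    and c: "self_adjoint c"
    and pd: "\<And>A. A \<in> pos_def_matrices \<Longrightarrow> F A + c \<in> pos_def_matrices"
  shows "psd c" and "\<And>A. psd A \<Longrightarrow> psd (F A)"
proof -
  have nonneg: "0 \<le> (F A *v x) \<bullet> x + (c *v x) \<bullet> x" if "A \<in> pos_def_matrices" for A x
    using psd_pos_def[OF pd[OF that]]
    by (simp add: psd_def matrix_vector_mult_add_rdistrib inner_left_distrib)
  have "0 \<le> (c *v x) \<bullet> x" for x
  proof (rule const_coeff_nonneg)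
    fix t :: real assume "0 < t"
    then show "0 \<le> t * ((F (mat 1) *v x) \<bullet> x) + (c *v x) \<bullet> x"
      using nonneg[OF pos_def_scaleR[OF _ pos_def_mat_1]]
      by (simp add: linear_scale[OF lin] matrix_vector_mult_scaleR_left)
  qed
  then show "psd c" using c by (simp add: psd_def)
  show "psd (F A)" if A: "psd A" for A
  proof -
    have "0 \<le> (F A *v x) \<bullet> x" for x
    proof (rule linear_coeff_nonneg)
      fix t :: real assume "0 < t"
      then show "0 \<le> t * ((F A *v x) \<bullet> x) + ((F (mat 1) *v x) \<bullet> x + (c *v x) \<bullet> x)"
        using nonneg[OF pos_def_add_psd[OF pos_def_mat_1 psd_scaleR[OF _ A]], of t x]
        by (simp add: linear_add[OF lin] linear_scale[OF lin] matrix_vector_mult_scaleR_left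
            matrix_vector_mult_add_rdistrib inner_left_distrib)
    qed
    then show ?thesis using A sa by (simp add: psd_def)
  qed
qed

section \<open>Linearization\<close>

text \<open>The pairing determines \<open>p' s - p' t\<close> from its values against the differences of \<open>q'\<close>, which
  exhaust the Hermitian matrices; hence it depends linearly on \<open>p s - p t\<close>. The extension to all
  matrices goes through the Hermitian part.\<close>

lemma dual_pair_linear:
  fixes p p' q q' :: "'i \<Rightarrow> complex ^ 'n ^ 'n"
  assumes sp: "\<And>s. s \<in> S \<Longrightarrow> self_adjoint (p s)" and sp': "\<And>s. s \<in> S \<Longrightarrow> self_adjoint (p' s)"
    and covp: "\<And>X. self_adjoint X \<Longrightarrow> \<exists>s\<in>S. \<exists>t\<in>S. X = p s - p t"
    and covq: "\<And>X. self_adjoint X \<Longrightarrow> \<exists>s\<in>S. \<exists>t\<in>S. X = q' s - q' t"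
    and pairing: "\<And>s t u v. s \<in> S \<Longrightarrow> t \<in> S \<Longrightarrow> u \<in> S \<Longrightarrow> v \<in> S \<Longrightarrow>
       (p' s - p' t) \<bullet> (q' u - q' v) = (p s - p t) \<bullet> (q u - q v)"
  obtains F where "linear F" and "\<And>X. self_adjoint X \<Longrightarrow> self_adjoint (F X)"
    and "\<And>s t. s \<in> S \<Longrightarrow> t \<in> S \<Longrightarrow> F (p s - p t) = p' s - p' t"
proof -
  have "\<forall>X. \<exists>st. self_adjoint X \<longrightarrow> fst st \<in> S \<and> snd st \<in> S \<and> X = p (fst st) - p (snd st)"
    using covp by (metis fst_conv snd_conv)
  then obtain f where f: "\<And>X. self_adjoint X \<Longrightarrow> fst (f X) \<in> S \<and> snd (f X) \<in> S \<and> X = p (fst (f X)) - p (snd (f X))"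
    using choice[of "\<lambda>X st. self_adjoint X \<longrightarrow> fst st \<in> S \<and> snd st \<in> S \<and> X = p (fst st) - p (snd st)"] by blast
  define F0 where "F0 X = p' (fst (f X)) - p' (snd (f X))" for X
  have F0sa: "self_adjoint (F0 X)" if "self_adjoint X" for X
    unfolding F0_def using f[OF that] by (intro self_adjoint_diff sp') auto
  \<comment> \<open>The right-hand side does not mention the pair chosen for \<open>X\<close>, so
    \<open>F0\<close> turns out to be independent of the choice.\<close>
  have key: "F0 X \<bullet> (q' u - q' v) = X \<bullet> (q u - q v)" if "self_adjoint X" "u \<in> S" "v \<in> S" for X u v
    unfolding F0_def using f[OF that(1)] pairing[of "fst (f X)" "snd (f X)" u v] that by metis
  have uniq: "Z = 0" if Z: "self_adjoint Z" "\<And>u v. u \<in> S \<Longrightarrow> v \<in> S \<Longrightarrow> Z \<bullet> (q' u - q' v) = 0" for Z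
  proof -
    obtain u v where "u \<in> S" "v \<in> S" "Z = q' u - q' v" using covq[OF Z(1)] by blast
    then have "Z \<bullet> Z = 0" using Z(2) by metis
    then show ?thesis by simp
  qed
  have F0_add: "F0 (X + Y) = F0 X + F0 Y" if XY: "self_adjoint X" "self_adjoint Y" for X Y
  proof -
    have "F0 (X + Y) - (F0 X + F0 Y) = 0"
      by (rule uniq) (simp_all add: XY F0sa self_adjoint_diff self_adjoint_add inner_diff_left
          inner_left_distrib key)
    then show ?thesis by simp
  qed
  have F0_scale: "F0 (r *\<^sub>R X) = r *\<^sub>R F0 X" if X: "self_adjoint X" for r X
  proof -
    have "F0 (r *\<^sub>R X) - r *\<^sub>R F0 X = 0"
      by (rule uniq) (simp_all add: X F0sa self_adjoint_diff self_adjoint_scaleR inner_diff_left key)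
    then show ?thesis by simp
  qed
  have F0_diff: "F0 (p s - p t) = p' s - p' t" if st: "s \<in> S" "t \<in> S" for s t
  proof -
    have "F0 (p s - p t) - (p' s - p' t) = 0"
    proof (rule uniq)
      show "self_adjoint (F0 (p s - p t) - (p' s - p' t))"
        by (intro self_adjoint_diff F0sa sp sp' st)
      show "(F0 (p s - p t) - (p' s - p' t)) \<bullet> (q' u - q' v) = 0" if "u \<in> S" "v \<in> S" for u v
        unfolding inner_diff_left[of "F0 _"]
        by (simp only: key self_adjoint_diff sp st that pairing diff_self)
    qed
    then show ?thesis by simp
  qed
  define h :: "complex ^ 'n ^ 'n \<Rightarrow> complex ^ 'n ^ 'n" where "h X = (1/2) *\<^sub>R (X + conj_transpose X)" for X
  have hsa: "self_adjoint (h X)" for X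
    by (simp add: h_def self_adjoint_def conj_transpose_scaleR conj_transpose_add add.commute)
  have hid: "h X = X" if "self_adjoint X" for X
    using that by (simp add: h_def self_adjoint_def flip: scaleR_2)
  have h_add: "h (X + Y) = h X + h Y" for X Y
    by (simp add: h_def conj_transpose_add scaleR_add_right)
  have h_scale: "h (r *\<^sub>R X) = r *\<^sub>R h X" for r X
    by (simp add: h_def conj_transpose_scaleR scaleR_add_right)
  have "linear (\<lambda>X. F0 (h X))"
    by (rule linearI) (simp_all only: h_add h_scale F0_add F0_scale hsa)
  then show ?thesis
    by (rule that) (simp_all only: hid F0sa F0_diff self_adjoint_diff sp)
qed

section \<open>Unitary and antiunitary conjugation\<close>

definition cnj_vec :: "complex ^ 'n \<Rightarrow> complex ^ 'n" where
  "cnj_vec x = (\<chi> i. cnj (x $ i))"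

lemma cnj_vec_cnj_vec [simp]: "cnj_vec (cnj_vec x) = x"
  by (simp add: cnj_vec_def)

text \<open>Conjugating the entries amounts to conjugating the operator by \<open>cnj_vec\<close>,
  which is how the antiunitary case enters.\<close>

lemma map_matrix_cnj_mult: "map_matrix cnj A *v x = cnj_vec (A *v cnj_vec x)"
  by (simp add: cnj_vec_def matrix_vector_mult_def)

lemma cinner_cnj_vec: "cinner (cnj_vec x) (cnj_vec y) = cinner y x"
  by (simp add: cinner_def cnj_vec_def mult.commute)

lemma unitary_matrix_cancel:
  assumes "unitary_matrix W"
  shows "W *v (conj_transpose W *v x) = x" "conj_transpose W *v (W *v x) = x"
  using assms by (simp_all add: matrix_vector_mul_assoc unitary_matrix_def)

lemma cinner_unitary_matrix: "unitary_matrix W \<Longrightarrow> cinner (W *v x) (W *v y) = cinner x y"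
  by (simp add: cinner_matrix unitary_matrix_cancel)

lemma unitary_conjugation:
  assumes W: "unitary_matrix W"
  defines "U \<equiv> (*v) W"
  shows "unitary_operator U"
    and "(*v) (W ** A ** conj_transpose W) = U \<circ> (*v) A \<circ> lin_adjoint U"
proof -
  have "bij U"
    unfolding U_def by (rule o_bij[of "(*v) (conj_transpose W)"]) (simp_all add: fun_eq_iff unitary_matrix_cancel[OF W])
  then show U: "unitary_operator U"
    unfolding unitary_operator_def U_def
    by (simp add: cinner_unitary_matrix[OF W] matrix_vector_mul_linear_gen)
  have "inv U = (*v) (conj_transpose W)"
    unfolding U_def by (rule inv_equality) (simp_all add: unitary_matrix_cancel[OF W])
  then show "(*v) (W ** A ** conj_transpose W) = U \<circ> (*v) A \<circ> lin_adjoint U"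
    unfolding lin_adjoint_unitary[OF U] by (simp add: fun_eq_iff U_def flip: matrix_vector_mul_assoc)
qed

text \<open>The adjoint of \<open>U\<close> is its inverse, so the two coordinatewise conjugations
  around \<open>A\<close> produce the entrywise conjugate of \<open>A\<close>.\<close>

lemma antiunitary_conjugation:
  assumes W: "unitary_matrix W"
  defines "U \<equiv> (\<lambda>x. W *v cnj_vec x)"
  shows "antiunitary_operator U"
    and "(*v) (W ** map_matrix cnj A ** conj_transpose W) = U \<circ> (*v) A \<circ> conj_lin_adjoint U"
proof -
  define U' where "U' y = cnj_vec (conj_transpose W *v y)" for y
  have U': "U (U' y) = y" "U' (U y) = y" for y
    by (simp_all add: U_def U'_def unitary_matrix_cancel[OF W])
  have "bij U"
    by (rule o_bij[of U']) (simp_all add: fun_eq_iff U')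
  moreover have "conj_linear U"
  proof -
    have "cnj_vec (x + y) = cnj_vec x + cnj_vec y" "cnj_vec (c *s x) = cnj c *s cnj_vec x" for x y :: "complex ^ 'a" and c
      by (simp_all add: cnj_vec_def vec_eq_iff)
    then show ?thesis
      by (simp add: conj_linear_def U_def matrix_vector_right_distrib vector_scalar_commute)
  qed
  ultimately show U: "antiunitary_operator U"
    by (simp add: antiunitary_operator_def U_def cinner_unitary_matrix[OF W] cinner_cnj_vec)
  have "inv U = U'" by (rule inv_equality) (simp_all add: U')
  then show "(*v) (W ** map_matrix cnj A ** conj_transpose W) = U \<circ> (*v) A \<circ> conj_lin_adjoint U"
    unfolding conj_lin_adjoint_antiunitary[OF U]
    by (simp add: fun_eq_iff U_def U'_def map_matrix_cnj_mult flip: matrix_vector_mul_assoc)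
qed

text \<open>The pairing is a trace, and the factors \<open>W\<close> cancel by cyclicity.\<close>

lemma inner_unitary_conjugate:
  assumes W: "unitary_matrix W" and Y: "self_adjoint Y"
  shows "(W ** X ** conj_transpose W) \<bullet> (W ** Y ** conj_transpose W) = X \<bullet> Y"
proof -
  have "(W ** X ** conj_transpose W) ** (W ** Y ** conj_transpose W)
      = W ** X ** (conj_transpose W ** W) ** Y ** conj_transpose W"
    by (simp only: matrix_mul_assoc)
  also have "\<dots> = W ** (X ** Y ** conj_transpose W)"
    using W by (simp add: unitary_matrix_def matrix_mul_assoc)
  also have "trace \<dots> = trace (X ** Y ** conj_transpose W ** W)"
    by (rule trace_mul_sym)
  also have "X ** Y ** conj_transpose W ** W = X ** Y"
    using W by (simp add: unitary_matrix_def flip: matrix_mul_assoc)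
  finally show ?thesis
    by (simp add: Y self_adjoint_conjugate flip: Re_trace_mult)
qed

lemma inner_map_matrix_cnj: "map_matrix cnj X \<bullet> map_matrix cnj Y = X \<bullet> Y"
  by (simp add: inner_vec_def inner_complex_def)

lemma self_adjoint_map_matrix_cnj: "self_adjoint X \<Longrightarrow> self_adjoint (map_matrix cnj X)"
proof -
  assume "self_adjoint X"
  moreover have "conj_transpose (map_matrix cnj X) = map_matrix cnj (conj_transpose X)"
    by (simp add: vec_eq_iff)
  ultimately show ?thesis by (simp add: self_adjoint_def)
qed

section \<open>Relative entropy\<close>

lemma relative_entropy_inner:
  assumes "A \<in> pos_def_matrices" "B \<in> pos_def_matrices"
  shows "Re (trace (A ** (matrix_log A - matrix_log B) - (A - B)))
       = A \<bullet> (matrix_log A - matrix_log B) - Re (trace A) + Re (trace B)"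
  using assms by (simp add: pos_def_iff trace_sub Re_trace_mult self_adjoint_diff self_adjoint_log)

text \<open>In the alternating sum over the pairs \<open>(A, C)\<close>, \<open>(A, D)\<close>,
  \<open>(B, C)\<close>, \<open>(B, D)\<close> every term depending on one argument only cancels,
  leaving the bilinear term.\<close>

lemma relative_entropy_four_points:
  assumes maps: "\<And>A. A \<in> pos_def_matrices \<Longrightarrow> \<phi> A \<in> pos_def_matrices"
    and preserves: "\<And>A B. A \<in> pos_def_matrices \<Longrightarrow> B \<in> pos_def_matrices \<Longrightarrow>
      trace (\<phi> A ** (matrix_log (\<phi> A) - matrix_log (\<phi> B)) - (\<phi> A - \<phi> B)) =
      trace (A ** (matrix_log A - matrix_log B) - (A - B))"
    and P: "A \<in> pos_def_matrices" "B \<in> pos_def_matrices" "C \<in> pos_def_matrices" "D \<in> pos_def_matrices"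
  shows "(\<phi> A - \<phi> B) \<bullet> (matrix_log (\<phi> C) - matrix_log (\<phi> D)) = (A - B) \<bullet> (matrix_log C - matrix_log D)"
proof -
  have eq: "\<phi> X \<bullet> (matrix_log (\<phi> X) - matrix_log (\<phi> Y)) - Re (trace (\<phi> X)) + Re (trace (\<phi> Y))
      = X \<bullet> (matrix_log X - matrix_log Y) - Re (trace X) + Re (trace Y)"
    if "X \<in> pos_def_matrices" "Y \<in> pos_def_matrices" for X Y
    using arg_cong[OF preserves[OF that], of Re] that maps by (simp only: relative_entropy_inner)
  show ?thesis
    using eq[OF P(1) P(3)] eq[OF P(1) P(4)] eq[OF P(2) P(3)] eq[OF P(2) P(4)]
    by (simp add: inner_diff_left inner_diff_right)
qed

lemma matrix_log_differences:
  assumes "self_adjoint X"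
  shows "\<exists>A\<in>pos_def_matrices. \<exists>B\<in>pos_def_matrices. X = matrix_log A - matrix_log B"
  using matrix_log_surj[OF assms] matrix_log_surj[OF self_adjoint_0] by (metis diff_zero)

theorem theorem4:
  fixes \<phi> :: "complex ^ 'n ^ 'n \<Rightarrow> complex ^ 'n ^ 'n"
  assumes maps: "\<And>A. A \<in> pos_def_matrices \<Longrightarrow> \<phi> A \<in> pos_def_matrices"
    and surj: "\<And>B. B \<in> pos_def_matrices \<Longrightarrow> \<exists>A\<in>pos_def_matrices. \<phi> A = B"
    and preserves: "\<And>A B. A \<in> pos_def_matrices \<Longrightarrow> B \<in> pos_def_matrices \<Longrightarrow>
      trace (\<phi> A ** (matrix_log (\<phi> A) - matrix_log (\<phi> B)) - (\<phi> A - \<phi> B)) =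
      trace (A ** (matrix_log A - matrix_log B) - (A - B))"
  shows "\<exists>U :: complex ^ 'n \<Rightarrow> complex ^ 'n.
    (unitary_operator U \<and>
       (\<forall>A\<in>pos_def_matrices. (*v) (\<phi> A) = U \<circ> (*v) A \<circ> lin_adjoint U)) \<or>
    (antiunitary_operator U \<and>
       (\<forall>A\<in>pos_def_matrices. (*v) (\<phi> A) = U \<circ> (*v) A \<circ> conj_lin_adjoint U))"
proof -
  let ?P = "pos_def_matrices :: (complex ^ 'n ^ 'n) set"
  let ?L = "matrix_log :: complex ^ 'n ^ 'n \<Rightarrow> _"
  let ?I = "mat 1 :: complex ^ 'n ^ 'n"

  \<comment> \<open>Linearization of the map, of its inverse and of its action on logarithms\<close>
  have pairing: "(\<phi> A - \<phi> B) \<bullet> (?L (\<phi> C) - ?L (\<phi> D)) = (A - B) \<bullet> (?L C - ?L D)"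
    if "A \<in> ?P" "B \<in> ?P" "C \<in> ?P" "D \<in> ?P" for A B C D
    using relative_entropy_four_points[of \<phi>, OF maps preserves that] .
  have sa: "self_adjoint A" if "A \<in> ?P" for A using that by (simp add: pos_def_iff)
  have sa\<phi>: "self_adjoint (\<phi> A)" if "A \<in> ?P" for A by (intro sa maps that)
  have saL: "self_adjoint (?L A)" if "A \<in> ?P" for A by (intro self_adjoint_log sa that)
  have saL\<phi>: "self_adjoint (?L (\<phi> A))" if "A \<in> ?P" for A by (intro saL maps that)
  have cov\<phi>: "\<exists>A\<in>?P. \<exists>B\<in>?P. X = \<phi> A - \<phi> B" if "self_adjoint X" for X
    using pos_def_differences[OF that] surj by metis
  have covL\<phi>: "\<exists>A\<in>?P. \<exists>B\<in>?P. X = ?L (\<phi> A) - ?L (\<phi> B)" if "self_adjoint X" for X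
    using matrix_log_differences[OF that] surj by metis
  obtain F where F: "linear F" and Fsa: "\<And>X. self_adjoint X \<Longrightarrow> self_adjoint (F X)"
    and F\<phi>: "\<And>A B. A \<in> ?P \<Longrightarrow> B \<in> ?P \<Longrightarrow> F (A - B) = \<phi> A - \<phi> B"
    using dual_pair_linear[where S = ?P and p = "\<lambda>A. A" and p' = \<phi> and q = ?L and q' = "\<lambda>A. ?L (\<phi> A)",
        OF sa sa\<phi> pos_def_differences covL\<phi> pairing] by blast
  \<comment> \<open>\<open>K\<close> arises by exchanging the roles of \<open>A\<close> and
    \<open>\<phi> A\<close>; it is the inverse of \<open>F\<close> on Hermitian matrices.\<close>
  obtain K where K: "linear K" and Ksa: "\<And>X. self_adjoint X \<Longrightarrow> self_adjoint (K X)"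
    and K\<phi>: "\<And>A B. A \<in> ?P \<Longrightarrow> B \<in> ?P \<Longrightarrow> K (\<phi> A - \<phi> B) = A - B"
    using dual_pair_linear[where S = ?P and p = \<phi> and p' = "\<lambda>A. A" and q = "\<lambda>A. ?L (\<phi> A)" and q' = ?L,
        OF sa\<phi> sa cov\<phi> matrix_log_differences pairing[symmetric]] by blast
  have "(?L (\<phi> A) - ?L (\<phi> B)) \<bullet> (\<phi> C - \<phi> D) = (?L A - ?L B) \<bullet> (C - D)"
    if "A \<in> ?P" "B \<in> ?P" "C \<in> ?P" "D \<in> ?P" for A B C D
    using pairing[of C D A B] that by (simp only: inner_commute)
  from dual_pair_linear[where S = ?P and p = ?L and p' = "\<lambda>A. ?L (\<phi> A)" and q = "\<lambda>A. A" and q' = \<phi>,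
      OF saL saL\<phi> matrix_log_differences cov\<phi> this]
  obtain G where G: "linear G" and Gsa: "\<And>X. self_adjoint X \<Longrightarrow> self_adjoint (G X)"
    and GL: "\<And>A B. A \<in> ?P \<Longrightarrow> B \<in> ?P \<Longrightarrow> G (?L A - ?L B) = ?L (\<phi> A) - ?L (\<phi> B)"
    by blast
  \<comment> \<open>With respect to the pairing of Hermitian matrices, \<open>G\<close> is the
    inverse of the adjoint of \<open>F\<close>.\<close>
  have FG: "F X \<bullet> G Y = X \<bullet> Y" if XY: "self_adjoint X" "self_adjoint Y" for X Y
  proof -
    obtain A B where "A \<in> ?P" "B \<in> ?P" "X = A - B" using pos_def_differences[OF XY(1)] by blast
    moreover obtain C D where "C \<in> ?P" "D \<in> ?P" "Y = ?L C - ?L D" using matrix_log_differences[OF XY(2)] by blast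
    ultimately show ?thesis by (simp only: F\<phi> GL pairing)
  qed
  have KF: "K (F X) = X" if "self_adjoint X" for X
    using pos_def_differences[OF that] F\<phi> K\<phi> by metis
  have FK: "F (K X) = X" if "self_adjoint X" for X
    using cov\<phi>[OF that] F\<phi> K\<phi> by metis
  have Gsurj: "\<exists>X. self_adjoint X \<and> G X = Y" if "self_adjoint Y" for Y
    using covL\<phi>[OF that] GL saL self_adjoint_diff by metis

  \<comment> \<open>Vanishing of the constant term\<close>
  define c where "c = \<phi> ?I - F ?I"
  have c: "self_adjoint c"
    unfolding c_def by (intro self_adjoint_diff sa\<phi> pos_def_mat_1 Fsa self_adjoint_mat_1)
  have \<phi>F: "\<phi> A = F A + c" if "A \<in> ?P" for A
    using F\<phi>[OF that pos_def_mat_1] by (simp add: c_def linear_diff[OF F] algebra_simps)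
  \<comment> \<open>The inverse of \<open>\<phi>\<close> is affine too and, by surjectivity, maps
    positive definite matrices to positive definite ones.\<close>
  have inv_affine: "K B + - K c \<in> ?P" if B: "B \<in> ?P" for B
  proof -
    obtain A where A: "A \<in> ?P" "\<phi> A = B" using surj[OF B] by blast
    have "K B = K (F A + c)" using A \<phi>F[OF A(1)] by simp
    then have "K B + - K c = K (F A)" by (simp add: linear_add[OF K])
    then show ?thesis using A by (simp add: KF sa)
  qed
  have affine: "F A + c \<in> ?P" if "A \<in> ?P" for A using maps[OF that] \<phi>F[OF that] by simp
  have sa_inv: "self_adjoint (- K c)" by (intro self_adjoint_minus Ksa c)
  have c_psd: "psd c" by (rule affine_pos_def_preserver(1)[OF F _ c]) (assumption | rule Fsa affine)+
  have psdF: "psd (F A)" if "psd A" for A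
    by (rule affine_pos_def_preserver(2)[OF F _ c]) (assumption | rule Fsa affine that)+
  have inv_c_psd: "psd (- K c)"
    by (rule affine_pos_def_preserver(1)[OF K _ sa_inv]) (assumption | rule Ksa inv_affine)+
  have psdK: "psd (K A)" if "psd A" for A
    by (rule affine_pos_def_preserver(2)[OF K _ sa_inv]) (assumption | rule Ksa inv_affine that)+
  \<comment> \<open>Positivity of the constant of the inverse is carried back by \<open>F\<close>,
    giving the opposite sign for \<open>c\<close>.\<close>
  have "psd (F (- K c))" by (intro psdF inv_c_psd)
  then have "psd (- c)" by (simp add: linear_neg[OF F] FK c)
  then have "c = 0" using c_psd psd_antisym by blast
  then have \<phi>: "\<phi> A = F A" if "A \<in> ?P" for A using \<phi>F[OF that] by simp

  \<comment> \<open>The dual map as a unital order isomorphism\<close>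
  have G1: "G ?I = ?I"
  proof -
    \<comment> \<open>The scalar \<open>exp 1\<close> has logarithm 1, so scaling by it shifts the
      logarithms of both \<open>?I\<close> and \<open>\<phi> ?I\<close> by the identity.\<close>
    have e: "exp 1 *\<^sub>R ?I \<in> ?P" by (intro pos_def_scaleR pos_def_mat_1) simp
    have "\<phi> (exp 1 *\<^sub>R ?I) = exp 1 *\<^sub>R \<phi> ?I"
      by (simp only: \<phi> e pos_def_mat_1 linear_scale[OF F])
    then show ?thesis
      using GL[OF e pos_def_mat_1] matrix_log_scaleR[OF pos_def_mat_1, of "exp 1", where 'a = 'n]
        matrix_log_scaleR[OF maps[OF pos_def_mat_1], of "exp 1"]
      by simp
  qed
  \<comment> \<open>Positivity is tested by pairing with the cone: positivity of \<open>F\<close>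
    serves for one direction, that of its inverse \<open>K\<close> for the other.\<close>
  have psdG: "psd (G Y) \<longleftrightarrow> psd Y" if Y: "self_adjoint Y" for Y
  proof
    assume GY: "psd (G Y)"
    have "0 \<le> Y \<bullet> X" if X: "psd X" for X
      using psd_inner_nonneg[OF psdF[OF X] GY] FG[OF _ Y] X by (simp add: psd_def inner_commute)
    then show "psd Y" using Y psd_iff_inner by blast
  next
    assume "psd Y"
    have "0 \<le> G Y \<bullet> Z" if Z: "psd Z" for Z
    proof -
      have "self_adjoint Z" using Z psd_def by blast
      then have "K Z \<bullet> Y = Z \<bullet> G Y" using FG[OF Ksa Y, of Z] FK by simp
      then show ?thesis using psd_inner_nonneg[OF psdK[OF Z] \<open>psd Y\<close>] by (simp add: inner_commute)
    qed
    then show "psd (G Y)" using Gsa[OF Y] psd_iff_inner by blast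
  qed

  \<comment> \<open>Identification of the maps\<close>
  obtain W where W: "unitary_matrix W"
    and GW: "(\<forall>X. self_adjoint X \<longrightarrow> G X = W ** X ** conj_transpose W) \<or>
         (\<forall>X. self_adjoint X \<longrightarrow> G X = W ** map_matrix cnj X ** conj_transpose W)"
    using rank_one_preserver[OF G order_isomorphism_rank_one[OF G psdG Gsurj] G1] by blast
  have Giso: "G X \<bullet> G Y = X \<bullet> Y" if "self_adjoint X" "self_adjoint Y" for X Y
    using GW that
    by (auto simp: inner_unitary_conjugate[OF W] inner_map_matrix_cnj self_adjoint_map_matrix_cnj)
  have "F X = G X" if X: "self_adjoint X" for X
  proof -
    \<comment> \<open>\<open>F X - G X\<close> is orthogonal to the image of the Hermitian matrices
      under \<open>G\<close>, which contains it.\<close>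
    obtain Y where Y: "self_adjoint Y" "G Y = F X - G X"
      using Gsurj self_adjoint_diff[OF Fsa[OF X] Gsa[OF X]] by blast
    have "(F X - G X) \<bullet> G Y = 0"
      using FG[OF X Y(1)] Giso[OF X Y(1)] by (simp only: inner_diff_left)
    then show ?thesis using Y by simp
  qed
  then have "\<phi> A = G A" if "A \<in> ?P" for A using \<phi> sa that by simp
  with GW have "(\<forall>A\<in>?P. \<phi> A = W ** A ** conj_transpose W) \<or>
      (\<forall>A\<in>?P. \<phi> A = W ** map_matrix cnj A ** conj_transpose W)"
    using sa by auto
  then show ?thesis
    using unitary_conjugation[OF W] antiunitary_conjugation[OF W] by metis
qed

end
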